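(* Let $X$ be a compact metrizable abelian group and let $\mathbf{u}=\{u_n\}$ be a sequence in $\widehat{X}$. Then the characterized subgroup $s_{\mathbf{u}}(X)=\{x\in X:(u_n,x)\to 1\}$ admits a locally quasi-convex Polish group topology.
   Context: $\mathbb{T}=\{z\in\mathbb{C}:|z|=1\}$; $\widehat{Y}$ denotes the group of continuous characters $Y\to\mathbb{T}$ of an abelian topological group $Y$, and $(\chi,y)$ is the value of $\chi$ at $y$. Let $\mathbb{T}_+=\{z\in\mathbb{T}:\mathrm{Re}\,z\ge 0\}$. A subset $A$ of an abelian topological group $Y$ is quasi-convex if for every $y\in Y\setminus A$ there is $\chi\in\widehat{Y}$ with $\chi(A)\subset\mathbb{T}_+$ and $\chi(y)\notin\mathbb{T}_+$. $Y$ is locally quasi-convex if it has a neighbourhood base at the neutral element consisting of quasi-convex sets. A Polish group topology is a group topology that is separable and completely metrizable. *)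

theory Defs
  imports "HOL-Analysis.Analysis" "HOL-Algebra.Group"
begin

text \<open>
  A topological group is a group in the sense of HOL-Algebra together with an abstract topology on
  its carrier, so that a subgroup can be given a topology other than the subspace topology.
  The Hausdorff property is not part of the notion; it follows wherever metrizability is assumed.
\<close>

locale abelian_topological_group = comm_group G
  for G :: "('a, 'b) monoid_scheme" (structure) and T :: "'a topology" +
  assumes topspace_eq_carrier: "topspace T = carrier G"
    and continuous_map_mult: "continuous_map (prod_topology T T) T (\<lambda>(x, y). x \<otimes> y)"
    and continuous_map_inv: "continuous_map T T (\<lambda>x. inv x)"

definition circle_group :: "complex monoid" where
  "circle_group = \<lparr>carrier = sphere 0 1, mult = (*), one = 1\<rparr>"

text \<open>
  The elements of the dual group. As for \<^const>\<open>hom\<close>, values outside the carrier are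
  unconstrained; nothing below depends on them.
\<close>

definition characters :: "('a, 'b) monoid_scheme \<Rightarrow> 'a topology \<Rightarrow> ('a \<Rightarrow> complex) set" where
  "characters G T =
     {\<phi> \<in> hom G circle_group. continuous_map T (top_of_set (carrier circle_group)) \<phi>}"

definition right_half_circle :: "complex set" where
  "right_half_circle = {z \<in> carrier circle_group. Re z \<ge> 0}"

definition quasi_convex :: "('a, 'b) monoid_scheme \<Rightarrow> 'a topology \<Rightarrow> 'a set \<Rightarrow> bool" where
  "quasi_convex G T A \<longleftrightarrow> A \<subseteq> carrier G \<and>
     (\<forall>y \<in> carrier G - A. \<exists>\<phi> \<in> characters G T.
        \<phi> ` A \<subseteq> right_half_circle \<and> \<phi> y \<notin> right_half_circle)"

definition locally_quasi_convex :: "('a, 'b) monoid_scheme \<Rightarrow> 'a topology \<Rightarrow> bool" where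
  "locally_quasi_convex G T \<longleftrightarrow> neighbourhood_base_at \<one>\<^bsub>G\<^esub> (quasi_convex G T) T"

definition polish_group_topology :: "('a, 'b) monoid_scheme \<Rightarrow> 'a topology \<Rightarrow> bool" where
  "polish_group_topology G T \<longleftrightarrow>
     abelian_topological_group G T \<and> separable_space T \<and> completely_metrizable_space T"

definition characterized_subgroup ::
  "('a, 'b) monoid_scheme \<Rightarrow> (nat \<Rightarrow> 'a \<Rightarrow> complex) \<Rightarrow> 'a set" where
  "characterized_subgroup G u = {x \<in> carrier G. (\<lambda>n. u n x) \<longlonglongrightarrow> 1}"

end

theory Submission
  imports Defs "HOL-Complex_Analysis.Great_Picard"
begin

text \<open>
  The topology on the characterized subgroup is the one of uniform convergence along the sequence:
  if characters \<open>\<theta>\<^sub>0, \<theta>\<^sub>1, \<dots>\<close> of \<open>X\<close>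
  separate points, the distance of \<open>x\<close> and \<open>y\<close> is the supremum of all
  \<open>\<bar>(u\<^sub>n, x) - (u\<^sub>n, y)\<bar>\<close> and all \<open>\<epsilon>\<^sub>n
  \<bar>(\<theta>\<^sub>n, x) - (\<theta>\<^sub>n, y)\<bar>\<close>, where the weights
  \<open>\<epsilon>\<^sub>n > 0\<close> tend to \<open>0\<close>. This distance is invariant. It is
  complete because \<open>X\<close> is compact and uniform limits of sequences tending to
  \<open>1\<close> tend to \<open>1\<close>. It is separable because \<open>X\<close> is, and
  because elements of the subgroup with uniformly small tails differ essentially in finitely many
  coordinates. Small balls around \<open>\<one>\<close> contain, and are contained in, sets given by
  conditions \<open>Re (\<psi>, x) \<ge> 0\<close> on powers \<open>\<psi>\<close> of the characters
  involved, and such sets are quasi-convex.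

  What remains is the classical fact that the characters of \<open>X\<close> separate points. It is
  proved here by an extremal argument. Averaging over long segments of powers of the members of a
  dense sequence yields an invariant mean \<open>M\<close> on the continuous functions
  (\<open>invariant_mean_exists\<close>). For continuous \<open>p\<close> consider the correlations
  \<open>h x = M (\<lambda>y. p (x \<otimes> y) * g y)\<close> with \<open>M \<bar>g\<bar>\<^sup>2
  \<le> 1\<close>, and the mean square of the autocorrelation \<open>\<phi> x = M (\<lambda>y. h (x
  \<otimes> y) * cnj (h y))\<close>. In terms of Fourier coefficients this is the sum of the fourth
  powers of the absolute values of those of \<open>h\<close>, which is largest when only one
  character occurs in \<open>h\<close>. Directly: comparing \<open>g\<close> with the functions
  \<open>y \<mapsto> g y + c * g (z \<otimes> y)\<close>, \<open>\<bar>c\<bar> = 1\<close>, shows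
  that for an almost maximal \<open>g\<close> the function \<open>\<phi>\<close> is almost
  proportional to its symmetrized translates (\<open>energy_defect\<close>). The functions
  \<open>h\<close> are equicontinuous, so there is a limit for which \<open>\<phi>\<close> is
  exactly proportional to all its translates (\<open>extremal_autocorrelation\<close>), that is, a
  multiple of a character. For \<open>p y = f y - f (a \<otimes> y)\<close>, with \<open>f\<close> a
  continuous function distinguishing \<open>a\<close> from \<open>\<one>\<close>, that character
  cannot be trivial at \<open>a\<close> (\<open>character_separating_from_one\<close>).
\<close>

section \<open>Continuous functions on a compact abelian group\<close>

lemma compact_metrizable_imp_second_countable:
  assumes "compact_space T" "metrizable_space T"
  shows "second_countable T"
proof -
  obtain M d where "Metric_space M d" and T: "T = Metric_space.mtopology M d"
    using assms(2) unfolding metrizable_space_def by blast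
  interpret Metric_space M d by fact
  have "mtotally_bounded M"
    using assms(1) T compactin_imp_mtotally_bounded by (simp add: compact_space_def)
  then have "\<forall>n::nat. \<exists>K. finite K \<and> K \<subseteq> M \<and> M \<subseteq> (\<Union>x\<in>K. mball x (inverse (Suc n)))"
    unfolding mtotally_bounded_def by simp
  then obtain K where K: "\<And>n::nat. finite (K n)" "\<And>n. K n \<subseteq> M"
      "\<And>n. M \<subseteq> (\<Union>x\<in>K n. mball x (inverse (Suc n)))"
    by metis
  define \<B> where "\<B> = (\<Union>n. (\<lambda>x. mball x (inverse (Suc n))) ` K n)"
  show ?thesis
    unfolding second_countable_def
  proof (intro exI[of _ \<B>] conjI ballI allI impI)
    show "countable \<B>"
      unfolding \<B>_def using K(1) by (intro countable_UN countable_image) (auto intro: countable_finite)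
    show "openin T V" if "V \<in> \<B>" for V
      using that unfolding \<B>_def T by auto
    fix U x assume U: "openin T U \<and> x \<in> U"
    then have "U \<subseteq> M" "x \<in> U" "\<exists>r>0. mball x r \<subseteq> U"
      unfolding T openin_mtopology by simp_all
    then obtain r where r: "r > 0" "mball x r \<subseteq> U" and x: "x \<in> M"
      by blast
    obtain n where n: "inverse (real (Suc n)) < r/2"
      using r(1) reals_Archimedean[of "r/2"] by auto
    obtain c where c: "c \<in> K n" "x \<in> mball c (inverse (Suc n))"
      using K(3)[of n] x by auto
    have "mball c (inverse (Suc n)) \<subseteq> mball x r"
    proof
      fix y assume y: "y \<in> mball c (inverse (Suc n))"
      then show "y \<in> mball x r"
        using c n triangle[of x c y] commute[of x c] by (auto simp del: of_nat_Suc)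
    qed
    with r c show "\<exists>V\<in>\<B>. x \<in> V \<and> V \<subseteq> U"
      unfolding \<B>_def by blast
  qed
qed

context abelian_topological_group
begin

abbreviation continuous_function :: "('a \<Rightarrow> complex) \<Rightarrow> bool" where
  "continuous_function \<equiv> continuous_map T euclidean"

lemma continuous_translation:
  assumes "z \<in> carrier G"
  shows "continuous_map T T (\<lambda>x. z \<otimes> x)"
proof -
  have "continuous_map T (prod_topology T T) (\<lambda>x. (z, x))"
    using assms by (intro continuous_map_pairedI) (auto simp: topspace_eq_carrier)
  from continuous_map_compose[OF this continuous_map_mult] show ?thesis
    by (simp add: o_def)
qed

lemma continuous_function_translate:
  assumes "continuous_function f" "z \<in> carrier G"
  shows "continuous_function (\<lambda>x. f (z \<otimes> x))"
  using continuous_map_compose[OF continuous_translation[OF assms(2)] assms(1)] by (simp add: o_def)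

lemma continuous_function_cong:
  assumes "continuous_function f" "\<And>x. x \<in> carrier G \<Longrightarrow> f x = g x"
  shows "continuous_function g"
  using continuous_map_eq[OF assms(1)] assms(2) by (simp add: topspace_eq_carrier)

lemma continuous_function_mult:
  assumes "continuous_function f" "continuous_function g"
  shows "continuous_function (\<lambda>x. f x * g x)"
  using assms unfolding continuous_map_atin by (auto intro!: tendsto_intros)

lemma continuous_function_compose:
  assumes "continuous_function f" "continuous_on UNIV h"
  shows "continuous_map T euclidean (\<lambda>x. h (f x))"
proof -
  have "continuous_map euclidean euclidean h"
    using assms(2) by simp
  from continuous_map_compose[OF assms(1) this] show ?thesis by (simp add: o_def)
qed

lemma continuous_function_cnj:
  "continuous_function f \<Longrightarrow> continuous_function (\<lambda>x. cnj (f x))"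
  by (rule continuous_function_compose) (auto intro!: continuous_intros)

lemma continuous_function_cmult:
  "continuous_function f \<Longrightarrow> continuous_function (\<lambda>x. c * f x)"
  by (rule continuous_function_compose) (auto intro!: continuous_intros)

lemma continuous_function_const: "continuous_function (\<lambda>x. c)"
  by simp

lemmas continuous_function_intros =
  continuous_map_add continuous_map_diff continuous_function_mult continuous_function_cnj
  continuous_function_cmult continuous_function_translate

text \<open>
  Every neighbourhood of a point is a translate of a neighbourhood of \<open>\<one>\<close>, so
  smallness of the increments near \<open>\<one>\<close>, uniformly over the group, gives continuity
  everywhere.
\<close>

lemma continuous_function_if_increments_small:
  assumes "\<And>\<epsilon>. \<epsilon> > 0 \<Longrightarrow> \<exists>U. openin T U \<and> \<one> \<in> U \<and>
      (\<forall>v\<in>U. \<forall>x\<in>carrier G. norm (f (v \<otimes> x) - f x) \<le> \<epsilon>)"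
  shows "continuous_function f"
proof -
  have "continuous_map T Met_TC.mtopology f"
    unfolding Met_TC.continuous_map_to_metric
  proof (intro ballI allI impI)
    fix x and \<epsilon> :: real assume x: "x \<in> topspace T" and \<epsilon>: "\<epsilon> > 0"
    obtain U where U: "openin T U" "\<one> \<in> U" "\<And>v y. v \<in> U \<Longrightarrow> y \<in> carrier G \<Longrightarrow> norm (f (v \<otimes> y) - f y) \<le> \<epsilon>/2"
      using assms[of "\<epsilon>/2"] \<epsilon> by auto
    have xG: "x \<in> carrier G" using x by (simp add: topspace_eq_carrier)
    let ?V = "{y \<in> topspace T. inv x \<otimes> y \<in> U}"
    have "openin T ?V"
      using openin_continuous_map_preimage[OF continuous_translation U(1)] xG by simp
    moreover have "x \<in> ?V" using xG x U by simp
    moreover have "f y \<in> Met_TC.mball (f x) \<epsilon>" if y: "y \<in> ?V" for y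
    proof -
      have yG: "y \<in> carrier G" using y by (simp add: topspace_eq_carrier)
      have "(inv x \<otimes> y) \<otimes> x = y"
        using xG yG by (simp add: m_comm m_assoc[symmetric])
      then have "norm (f y - f x) \<le> \<epsilon>/2"
        using U(3)[of "inv x \<otimes> y" x] y xG by auto
      then show ?thesis using \<epsilon> by (simp add: dist_norm norm_minus_commute)
    qed
    ultimately show "\<exists>U. openin T U \<and> x \<in> U \<and> (\<forall>y\<in>U. f y \<in> Met_TC.mball (f x) \<epsilon>)" by blast
  qed
  then show ?thesis by simp
qed

end

locale compact_metrizable_abelian_group = abelian_topological_group +
  assumes compact: "compact_space T" and metrizable: "metrizable_space T"
begin

lemma continuous_function_bounded:
  assumes "continuous_function f"
  obtains B where "B \<ge> 0" "\<And>x. x \<in> carrier G \<Longrightarrow> norm (f x) \<le> B"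
proof -
  have "compactin euclidean (f ` topspace T)"
    using image_compactin[OF _ assms] compact by (simp add: compact_space_def)
  then have "bounded (f ` carrier G)"
    by (simp add: compact_imp_bounded topspace_eq_carrier)
  then obtain B where "\<forall>x\<in>carrier G. norm (f x) \<le> B" unfolding bounded_iff by auto
  then show thesis using that[of "max 0 B"] by (simp add: max.coboundedI2)
qed

text \<open>
  Uniform continuity: the increment \<open>f (v \<otimes> x) - f x\<close> vanishes on the compact
  set \<open>{\<one>} \<times> X\<close>, hence is small on a tube around it.
\<close>

lemma increments_small:
  assumes f: "continuous_function f" and "\<epsilon> > 0"
  obtains U where "openin T U" "\<one> \<in> U"
    "\<And>v x. v \<in> U \<Longrightarrow> x \<in> carrier G \<Longrightarrow> norm (f (v \<otimes> x) - f x) < \<epsilon>"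
proof -
  let ?g = "\<lambda>p. norm (f (fst p \<otimes> snd p) - f (snd p))"
  have mult: "continuous_map (prod_topology T T) T (\<lambda>p. fst p \<otimes> snd p)"
    using continuous_map_mult by (simp add: case_prod_unfold)
  have "continuous_map (prod_topology T T) euclidean (\<lambda>p. f (fst p \<otimes> snd p))"
    using continuous_map_compose[OF mult f] by (simp add: o_def)
  moreover have "continuous_map (prod_topology T T) euclidean (\<lambda>p. f (snd p))"
    using continuous_map_compose[OF continuous_map_snd f] by (simp add: o_def)
  ultimately have g: "continuous_map (prod_topology T T) euclideanreal ?g"
    by (intro continuous_map_norm continuous_map_diff)
  have W: "openin (prod_topology T T) {p \<in> topspace (prod_topology T T). ?g p \<in> {..<\<epsilon>}}"
    by (rule openin_continuous_map_preimage[OF g]) simp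
  have C: "compactin T {\<one>}" "compactin T (topspace T)"
    using compact by (auto simp: compact_space_def topspace_eq_carrier)
  have sub: "{\<one>} \<times> topspace T \<subseteq> {p \<in> topspace (prod_topology T T). ?g p \<in> {..<\<epsilon>}}"
    using \<open>\<epsilon> > 0\<close> by (auto simp: topspace_eq_carrier)
  obtain U V where "openin T U" "openin T V" "{\<one>} \<subseteq> U" "topspace T \<subseteq> V"
      and UV: "U \<times> V \<subseteq> {p \<in> topspace (prod_topology T T). ?g p \<in> {..<\<epsilon>}}"
    by (rule Wallace_theorem_prod_topology[OF C W sub])
  show thesis
  proof (rule that[of U])
    fix v x assume "v \<in> U" "x \<in> carrier G"
    then have "(v, x) \<in> U \<times> V" using \<open>topspace T \<subseteq> V\<close> by (auto simp: topspace_eq_carrier)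
    with UV show "norm (f (v \<otimes> x) - f x) < \<epsilon>" by auto
  qed (use \<open>openin T U\<close> \<open>{\<one>} \<subseteq> U\<close> in auto)
qed

lemma second_countable: "second_countable T"
  using compact metrizable by (rule compact_metrizable_imp_second_countable)

text \<open>
  For every \<open>x\<close> the \<open>a\<close> with \<open>x \<otimes> inv a \<in> U\<close> form
  a neighbourhood of \<open>x\<close>, which meets the dense set \<open>D\<close>; so the translates
  of \<open>U\<close> by \<open>D\<close> form an open cover, and compactness leaves finitely many.
\<close>

lemma finite_translates_cover:
  assumes U: "openin T U" "\<one> \<in> U" and D: "D \<subseteq> carrier G" "T closure_of D = carrier G"
  obtains F where "finite F" "F \<subseteq> D" "\<And>x. x \<in> carrier G \<Longrightarrow> \<exists>a\<in>F. \<exists>v\<in>U. x = v \<otimes> a"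
proof -
  have UG: "U \<subseteq> carrier G" using openin_subset[OF U(1)] by (simp add: topspace_eq_carrier)
  define V where "V a = {x \<in> topspace T. inv a \<otimes> x \<in> U}" for a
  have V: "openin T (V a)" if "a \<in> carrier G" for a
    unfolding V_def using openin_continuous_map_preimage[OF continuous_translation U(1)] that by simp
  have cover: "\<exists>a\<in>D. x \<in> V a" if x: "x \<in> carrier G" for x
  proof -
    have "continuous_map T T (\<lambda>a. x \<otimes> inv a)"
      using continuous_map_compose[OF continuous_map_inv continuous_translation[OF x]]
      by (simp add: o_def)
    then have "openin T {a \<in> topspace T. x \<otimes> inv a \<in> U}"
      using U(1) by (rule openin_continuous_map_preimage)
    moreover have "x \<in> {a \<in> topspace T. x \<otimes> inv a \<in> U}"
      using x U by (simp add: topspace_eq_carrier)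
    moreover have "x \<in> T closure_of D" using x D by simp
    ultimately have "\<exists>a. a \<in> D \<and> a \<in> {a \<in> topspace T. x \<otimes> inv a \<in> U}"
      unfolding in_closure_of by presburger
    then obtain a where "a \<in> D" "x \<otimes> inv a \<in> U" by (elim exE conjE CollectE)
    then show ?thesis
      using x D m_comm[of x "inv a"] by (intro bexI[of _ a]) (auto simp: V_def topspace_eq_carrier)
  qed
  have "\<exists>\<F>. finite \<F> \<and> \<F> \<subseteq> V ` D \<and> topspace T \<subseteq> \<Union>\<F>"
  proof (rule compactinD)
    show "compactin T (topspace T)" using compact by (simp add: compact_space_def)
    show "openin T S" if "S \<in> V ` D" for S using that V D(1) by blast
    show "topspace T \<subseteq> \<Union>(V ` D)" using cover by (auto simp: topspace_eq_carrier)
  qed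
  then obtain \<F> where \<F>: "finite \<F>" "\<F> \<subseteq> V ` D" "topspace T \<subseteq> \<Union>\<F>" by blast
  obtain F where F: "finite F" "F \<subseteq> D" "topspace T \<subseteq> \<Union>(V ` F)"
    using finite_subset_image[OF \<F>(1,2)] \<F>(3) by blast
  show thesis
  proof (rule that[OF F(1,2)])
    fix x assume x: "x \<in> carrier G"
    then obtain a where a: "a \<in> F" "x \<in> V a" using F(3) by (auto simp: topspace_eq_carrier)
    have aG: "a \<in> carrier G" using a F D by auto
    have "x = (inv a \<otimes> x) \<otimes> a"
      using x aG by (simp add: m_comm m_assoc[symmetric])
    then show "\<exists>a\<in>F. \<exists>v\<in>U. x = v \<otimes> a" using a unfolding V_def by blast
  qed
qed

lemma dense_sequence:
  obtains e :: "nat \<Rightarrow> 'a" where "\<And>i. e i \<in> carrier G" "T closure_of range e = carrier G"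
proof -
  obtain C where C: "countable C" "C \<subseteq> topspace T" "T closure_of C = topspace T"
    using second_countable_imp_separable_space[OF second_countable] unfolding separable_space_def by auto
  have "C \<noteq> {}"
  proof
    assume "C = {}"
    with C(3) have "carrier G = {}" by (simp add: topspace_eq_carrier)
    with one_closed show False by simp
  qed
  then show thesis
  proof (intro that[of "from_nat_into C"])
    show "from_nat_into C i \<in> carrier G" if "C \<noteq> {}" for i
      using from_nat_into[OF that] C(2) by (auto simp: topspace_eq_carrier)
    show "T closure_of range (from_nat_into C) = carrier G" if "C \<noteq> {}"
      using range_from_nat_into[OF that C(1)] C(3) by (simp add: topspace_eq_carrier)
  qed
qed

end

section \<open>Invariant means\<close>

text \<open>
  The integral of continuous functions against Haar measure, described by the properties used
  below.  The last one combines positivity with the triangle inequality; the majorant is the real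
  part of a complex function because \<open>M\<close> acts on complex-valued functions.
\<close>

locale invariant_mean = compact_metrizable_abelian_group +
  fixes M :: "('a \<Rightarrow> complex) \<Rightarrow> complex"
  assumes mean_add: "\<lbrakk>continuous_function f; continuous_function g\<rbrakk> \<Longrightarrow> M (\<lambda>x. f x + g x) = M f + M g"
    and mean_cmult: "continuous_function f \<Longrightarrow> M (\<lambda>x. c * f x) = c * M f"
    and mean_one: "M (\<lambda>x. 1) = 1"
    and mean_translate:
      "\<lbrakk>continuous_function f; z \<in> carrier G\<rbrakk> \<Longrightarrow> M (\<lambda>x. f (z \<otimes> x)) = M f"
    and mean_cnj: "continuous_function f \<Longrightarrow> M (\<lambda>x. cnj (f x)) = cnj (M f)"
    and norm_mean_le: "\<lbrakk>continuous_function f; continuous_function F;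
      \<And>x. x \<in> carrier G \<Longrightarrow> norm (f x) \<le> Re (F x)\<rbrakk> \<Longrightarrow> norm (M f) \<le> Re (M F)"

context compact_metrizable_abelian_group
begin

definition average :: "nat \<Rightarrow> (nat \<Rightarrow> 'a) \<Rightarrow> ('a \<Rightarrow> complex) \<Rightarrow> 'a \<Rightarrow> complex" where
  "average n a f x = (\<Sum>i<n. f (a i \<otimes> x)) / of_nat n"

lemma norm_average_diff_le:
  assumes "n > 0" "\<And>i. i < n \<Longrightarrow> norm (f (a i \<otimes> x) - g (a i \<otimes> y)) \<le> B"
  shows "norm (average n a f x - average n a g y) \<le> B"
proof -
  have "average n a f x - average n a g y = (\<Sum>i<n. f (a i \<otimes> x) - g (a i \<otimes> y)) / of_nat n"
    unfolding average_def by (simp add: sum_subtractf diff_divide_distrib)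
  moreover have "norm (\<Sum>i<n. f (a i \<otimes> x) - g (a i \<otimes> y)) \<le> of_nat n * B"
    using sum_norm_bound[of "{..<n}" "\<lambda>i. f (a i \<otimes> x) - g (a i \<otimes> y)" B] assms(2) by simp
  ultimately show ?thesis
    using assms(1) by (simp add: norm_divide divide_le_eq mult.commute)
qed

lemma norm_average_le:
  assumes "n > 0" "\<And>i. i < n \<Longrightarrow> norm (f (a i \<otimes> x)) \<le> B"
  shows "norm (average n a f x) \<le> B"
  using norm_average_diff_le[of n f a x "\<lambda>_. 0" x B] assms by (simp add: average_def)

lemma average_const: "n > 0 \<Longrightarrow> average n a (\<lambda>_. c) x = c"
  by (simp add: average_def)

lemma average_commute:
  assumes "\<And>i. a i \<in> carrier G" "\<And>i. b i \<in> carrier G" "x \<in> carrier G"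
  shows "average n a (average m b f) x = average m b (average n a f) x"
proof -
  have "(\<Sum>i<n. \<Sum>j<m. f (b j \<otimes> (a i \<otimes> x))) = (\<Sum>j<m. \<Sum>i<n. f (a i \<otimes> (b j \<otimes> x)))"
    using assms by (subst sum.swap) (simp add: m_lcomm)
  then show ?thesis
    unfolding average_def by (simp add: sum_divide_distrib[symmetric] divide_divide_eq_left mult.commute)
qed

text \<open>
  Induction on \<open>E\<close>: averaging a given average further over the powers \<open>e [^] 0,
  \<dots>, e [^] (N-1)\<close> of a new element makes it almost invariant under \<open>e\<close>,
  since the difference telescopes to two terms out of \<open>N\<close>. The invariance achieved
  before survives, because the new average is a mean of translates of the old one.
\<close>

lemma almost_invariant_average:
  assumes "finite E" "E \<subseteq> carrier G" "\<epsilon> > 0"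
  shows "\<exists>n a. 0 < n \<and> (\<forall>i. a i \<in> carrier G) \<and>
    (\<forall>f B. (\<forall>x\<in>carrier G. norm (f x) \<le> B) \<longrightarrow>
      (\<forall>e\<in>E. \<forall>x\<in>carrier G. norm (average n a f (e \<otimes> x) - average n a f x) \<le> \<epsilon> * B))"
  using assms(1,2)
proof (induction E rule: finite_induct)
  case empty
  show ?case by (intro exI[of _ 1] exI[of _ "\<lambda>_. \<one>"]) auto
next
  case (insert e E)
  then obtain n a where n: "0 < n" and a: "\<And>i. a i \<in> carrier G"
    and IH: "\<And>f B e x. \<lbrakk>\<forall>x\<in>carrier G. norm (f x) \<le> B; e \<in> E; x \<in> carrier G\<rbrakk> \<Longrightarrow>
        norm (average n a f (e \<otimes> x) - average n a f x) \<le> \<epsilon> * B"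
    by (metis insert_subset)
  have e: "e \<in> carrier G" and E: "E \<subseteq> carrier G" using insert.prems by auto
  obtain N :: nat where "2 / \<epsilon> < N" using reals_Archimedean2 by blast
  moreover have "0 < 2 / \<epsilon>" using \<open>\<epsilon> > 0\<close> by simp
  ultimately have "0 < real N" by linarith
  with \<open>2 / \<epsilon> < N\<close> have N: "N > 0" "2 / N \<le> \<epsilon>"
    using \<open>\<epsilon> > 0\<close> by (simp_all add: field_simps)
  define b where "b i = e [^] (i div n) \<otimes> a (i mod n)" for i
  have b: "b i \<in> carrier G" for i unfolding b_def using a e by simp
  have avg: "average (N * n) b f x = (\<Sum>k<N. average n a f (e [^] k \<otimes> x)) / N"
    if x: "x \<in> carrier G" for f x
  proof -
    have "(\<Sum>i<N*n. f (b i \<otimes> x)) = (\<Sum>k<N. \<Sum>i=k*n..<k*n+n. f (b i \<otimes> x))"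
      by (rule sum.nat_group[symmetric])
    also have "\<dots> = (\<Sum>k<N. \<Sum>i<n. f (a i \<otimes> (e [^] k \<otimes> x)))"
    proof (rule sum.cong[OF refl])
      fix k
      have "(\<Sum>i=k*n..<k*n+n. f (b i \<otimes> x)) = (\<Sum>i<n. f (b (k*n+i) \<otimes> x))"
        by (subst sum.atLeastLessThan_shift_0) (simp add: atLeast0LessThan)
      also have "\<dots> = (\<Sum>i<n. f (a i \<otimes> (e [^] k \<otimes> x)))"
        using a e x by (intro sum.cong) (auto simp: b_def m_ac)
      finally show "(\<Sum>i=k*n..<k*n+n. f (b i \<otimes> x)) = (\<Sum>i<n. f (a i \<otimes> (e [^] k \<otimes> x)))" .
    qed
    finally show ?thesis
      unfolding average_def by (simp add: sum_divide_distrib[symmetric] mult.commute)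
  qed
  show ?case
  proof (intro exI[of _ "N * n"] exI[of _ b] conjI allI impI ballI)
    show "0 < N * n" using N n by simp
    show "b i \<in> carrier G" for i by (rule b)
    fix f :: "'a \<Rightarrow> complex" and B y x
    assume B: "\<forall>x\<in>carrier G. norm (f x) \<le> B" and y: "y \<in> insert e E" and x: "x \<in> carrier G"
    let ?A = "average n a f"
    have yG: "y \<in> carrier G" using y e E by auto
    have diff: "average (N*n) b f (y \<otimes> x) - average (N*n) b f x
        = (\<Sum>k<N. ?A (e [^] k \<otimes> (y \<otimes> x)) - ?A (e [^] k \<otimes> x)) / N"
      using x yG by (simp add: avg sum_subtractf diff_divide_distrib)
    show "norm (average (N*n) b f (y \<otimes> x) - average (N*n) b f x) \<le> \<epsilon> * B"
    proof (cases "y = e")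
      case True
      \<comment> \<open>The averages over the powers of \<open>e\<close> telescope.\<close>
      have "(\<Sum>k<N. ?A (e [^] k \<otimes> (e \<otimes> x)) - ?A (e [^] k \<otimes> x))
          = (\<Sum>k<N. ?A (e [^] Suc k \<otimes> x) - ?A (e [^] k \<otimes> x))"
        using e x by (simp add: m_assoc)
      also have "\<dots> = ?A (e [^] N \<otimes> x) - ?A (e [^] (0::nat) \<otimes> x)"
        by (rule sum_lessThan_telescope)
      finally have "average (N*n) b f (y \<otimes> x) - average (N*n) b f x
          = (?A (e [^] N \<otimes> x) - ?A (e [^] (0::nat) \<otimes> x)) / N"
        using diff True by simp
      moreover have "norm (?A z) \<le> B" if "z \<in> carrier G" for z
        using B a n that by (intro norm_average_le) auto
      then have "norm (?A (e [^] N \<otimes> x) - ?A (e [^] (0::nat) \<otimes> x)) \<le> B + B"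
        using e x by (intro order_trans[OF norm_triangle_ineq4] add_mono) auto
      ultimately have "norm (average (N*n) b f (y \<otimes> x) - average (N*n) b f x) \<le> (B + B) / N"
        using N by (simp add: norm_divide divide_right_mono)
      also have "\<dots> = (2 / N) * B" by simp
      also have "\<dots> \<le> \<epsilon> * B"
        using N B one_closed order_trans[OF norm_ge_zero] by (intro mult_right_mono) blast+
      finally show ?thesis .
    next
      case False
      then have "y \<in> E" using y by simp
      have "norm (?A (e [^] k \<otimes> (y \<otimes> x)) - ?A (e [^] k \<otimes> x)) \<le> \<epsilon> * B" for k :: nat
        using IH[OF B \<open>y \<in> E\<close>, of "e [^] k \<otimes> x"] e x yG by (simp add: m_lcomm)
      then have "norm (\<Sum>k<N. ?A (e [^] k \<otimes> (y \<otimes> x)) - ?A (e [^] k \<otimes> x)) \<le> of_nat N * (\<epsilon> * B)"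
        using sum_norm_bound[of "{..<N}" "\<lambda>k. ?A (e [^] k \<otimes> (y \<otimes> x)) - ?A (e [^] k \<otimes> x)" "\<epsilon> * B"]
        by simp
      then show ?thesis unfolding diff using N by (simp add: norm_divide divide_le_eq mult.commute)
    qed
  qed
qed

text \<open>
  Averages that are almost invariant under longer and longer segments of a dense sequence make
  every continuous function almost constant: by uniform continuity it suffices to compare values
  at finitely many members of the dense sequence.
\<close>

lemma flattening_averages:
  obtains n :: "nat \<Rightarrow> nat" and a :: "nat \<Rightarrow> nat \<Rightarrow> 'a"
  where "\<And>j. 0 < n j" "\<And>j i. a j i \<in> carrier G"
    "\<And>f \<epsilon>. \<lbrakk>continuous_function f; 0 < \<epsilon>\<rbrakk> \<Longrightarrow> \<exists>J. \<forall>j\<ge>J. \<forall>x\<in>carrier G.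
        norm (average (n j) (a j) f x - average (n j) (a j) f \<one>) \<le> \<epsilon>"
proof -
  obtain e :: "nat \<Rightarrow> 'a" where e: "\<And>i. e i \<in> carrier G" "T closure_of range e = carrier G"
    using dense_sequence by blast
  have "\<forall>j. \<exists>n a. 0 < n \<and> (\<forall>i. a i \<in> carrier G) \<and>
    (\<forall>f B. (\<forall>x\<in>carrier G. norm (f x) \<le> B) \<longrightarrow> (\<forall>y\<in>e ` {..j}. \<forall>x\<in>carrier G.
        norm (average n a f (y \<otimes> x) - average n a f x) \<le> inverse (real (Suc j)) * B))"
    using e(1) by (intro allI almost_invariant_average) auto
  then obtain n a where n: "\<And>j. 0 < n j" and a: "\<And>j i. a j i \<in> carrier G"
    and inv: "\<And>j f B y x. \<lbrakk>\<forall>x\<in>carrier G. norm (f x) \<le> B; y \<in> e ` {..j}; x \<in> carrier G\<rbrakk> \<Longrightarrow>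
        norm (average (n j) (a j) f (y \<otimes> x) - average (n j) (a j) f x) \<le> inverse (real (Suc j)) * B"
    by metis
  show thesis
  proof (rule that[OF n a])
    fix f and \<epsilon> :: real assume f: "continuous_function f" and \<epsilon>: "0 < \<epsilon>"
    obtain B where B: "B \<ge> 0" "\<And>x. x \<in> carrier G \<Longrightarrow> norm (f x) \<le> B"
      using continuous_function_bounded[OF f] by blast
    obtain U where U: "openin T U" "\<one> \<in> U"
      "\<And>v x. v \<in> U \<Longrightarrow> x \<in> carrier G \<Longrightarrow> norm (f (v \<otimes> x) - f x) < \<epsilon>/2"
      using increments_small[OF f, of "\<epsilon>/2"] \<epsilon> by auto
    have UG: "U \<subseteq> carrier G" using openin_subset[OF U(1)] by (simp add: topspace_eq_carrier)
    obtain F where F: "finite F" "F \<subseteq> range e" "\<And>x. x \<in> carrier G \<Longrightarrow> \<exists>y\<in>F. \<exists>v\<in>U. x = v \<otimes> y"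
      using finite_translates_cover[OF U(1,2) _ e(2)] e(1) by blast
    obtain I where I: "finite I" "F = e ` I" using finite_subset_image[OF F(1,2)] by auto
    obtain m where m: "I \<subseteq> {..m}" using finite_nat_iff_bounded_le I(1) by auto
    obtain k :: nat where k: "2 * B / \<epsilon> < k" using reals_Archimedean2 by blast
    show "\<exists>J. \<forall>j\<ge>J. \<forall>x\<in>carrier G. norm (average (n j) (a j) f x - average (n j) (a j) f \<one>) \<le> \<epsilon>"
    proof (intro exI[of _ "max m k"] allI impI ballI)
      fix j x assume j: "j \<ge> max m k" and x: "x \<in> carrier G"
      let ?A = "average (n j) (a j) f"
      obtain y v where y: "y \<in> F" "v \<in> U" "x = v \<otimes> y" using F(3)[OF x] by blast
      have yG: "y \<in> carrier G" and vG: "v \<in> carrier G" and ye: "y \<in> e ` {..j}"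
        using y I m j e UG by auto
      have "norm (?A x - ?A y) \<le> \<epsilon>/2"
      proof (rule norm_average_diff_le[OF n])
        fix i
        have "a j i \<otimes> x = v \<otimes> (a j i \<otimes> y)" using y(3) a yG vG by (simp add: m_lcomm)
        then show "norm (f (a j i \<otimes> x) - f (a j i \<otimes> y)) \<le> \<epsilon>/2"
          using U(3)[OF y(2), of "a j i \<otimes> y"] a yG by simp
      qed
      moreover have "norm (?A (y \<otimes> \<one>) - ?A \<one>) \<le> inverse (real (Suc j)) * B"
        using inv[OF _ ye] B by blast
      moreover have "inverse (real (Suc j)) * B \<le> \<epsilon>/2"
      proof -
        have "2 * B / \<epsilon> \<le> real (Suc j)" using k j by simp
        then show ?thesis using \<epsilon> by (simp add: field_simps)
      qed
      ultimately show "norm (?A x - ?A \<one>) \<le> \<epsilon>"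
        using yG norm_triangle_ineq[of "?A x - ?A y" "?A y - ?A \<one>"] by simp
    qed
  qed
qed

text \<open>
  The mean of \<open>f\<close> is the limit of the values at \<open>\<one>\<close> of the flattening
  averages. These are Cauchy: an average applied to an almost constant function hardly changes it,
  and averages commute, so the \<open>j\<close>-th and the \<open>k\<close>-th value are both close
  to the value of the composed average.
\<close>

theorem invariant_mean_exists: "\<exists>M. invariant_mean G T M"
proof -
  obtain n :: "nat \<Rightarrow> nat" and a :: "nat \<Rightarrow> nat \<Rightarrow> 'a"
    where n: "\<And>j. 0 < n j" and a: "\<And>j i. a j i \<in> carrier G"
    and flat: "\<And>f \<epsilon>. \<lbrakk>continuous_function f; 0 < \<epsilon>\<rbrakk> \<Longrightarrow> \<exists>J. \<forall>j\<ge>J. \<forall>x\<in>carrier G.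
        norm (average (n j) (a j) f x - average (n j) (a j) f \<one>) \<le> \<epsilon>"
    using flattening_averages by blast
  define A where "A j = average (n j) (a j)" for j
  define M where "M f = lim (\<lambda>j. A j f \<one>)" for f
  have lim: "(\<lambda>j. A j f \<one>) \<longlonglongrightarrow> M f" if f: "continuous_function f" for f
  proof -
    \<comment> \<open>Both values are compared with \<open>A k (A j f) \<one> = A j (A k f) \<one>\<close>.\<close>
    have "Cauchy (\<lambda>j. A j f \<one>)"
    proof (rule metric_CauchyI)
      fix \<epsilon> :: real assume "\<epsilon> > 0"
      then obtain J where J: "\<And>j x. \<lbrakk>j \<ge> J; x \<in> carrier G\<rbrakk> \<Longrightarrow> norm (A j f x - A j f \<one>) \<le> \<epsilon>/3"
        using flat[OF f, of "\<epsilon>/3"] unfolding A_def by auto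
      have *: "norm (A k (A j f) \<one> - A j f \<one>) \<le> \<epsilon>/3" if "j \<ge> J" for j k
      proof -
        have "norm (average (n k) (a k) (A j f) \<one> - average (n k) (a k) (\<lambda>_. A j f \<one>) \<one>) \<le> \<epsilon>/3"
          using n a J that by (intro norm_average_diff_le) auto
        then show ?thesis using n by (simp add: average_const A_def)
      qed
      have "dist (A j f \<one>) (A k f \<one>) < \<epsilon>" if "j \<ge> J" "k \<ge> J" for j k
      proof -
        have "A k (A j f) \<one> = A j (A k f) \<one>"
          unfolding A_def using a by (intro average_commute) auto
        then show ?thesis
          using *[OF that(1), of k] *[OF that(2), of j] \<open>\<epsilon> > 0\<close>
            norm_triangle_ineq4[of "A j (A k f) \<one> - A k f \<one>" "A k (A j f) \<one> - A j f \<one>"]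
          by (simp add: dist_norm norm_minus_commute)
      qed
      then show "\<exists>J. \<forall>j\<ge>J. \<forall>k\<ge>J. dist (A j f \<one>) (A k f \<one>) < \<epsilon>" by blast
    qed
    then show ?thesis unfolding M_def by (simp add: Cauchy_convergent_iff convergent_LIMSEQ_iff)
  qed
  have "invariant_mean G T M"
  proof
    show "M (\<lambda>x. f x + g x) = M f + M g" if "continuous_function f" "continuous_function g" for f g
    proof (rule LIMSEQ_unique[OF lim])
      show "continuous_function (\<lambda>x. f x + g x)" by (intro continuous_map_add that)
      show "(\<lambda>j. A j (\<lambda>x. f x + g x) \<one>) \<longlonglongrightarrow> M f + M g"
        using tendsto_add[OF lim lim, OF that]
        by (simp add: A_def average_def sum.distrib add_divide_distrib)
    qed
    show "M (\<lambda>x. c * f x) = c * M f" if "continuous_function f" for c f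
    proof (rule LIMSEQ_unique[OF lim])
      show "continuous_function (\<lambda>x. c * f x)" by (intro continuous_function_cmult that)
      show "(\<lambda>j. A j (\<lambda>x. c * f x) \<one>) \<longlonglongrightarrow> c * M f"
        using tendsto_mult_left[OF lim, OF that, of c]
        by (simp add: A_def average_def sum_distrib_left)
    qed
    show "M (\<lambda>x. 1) = 1"
      unfolding M_def A_def using n by (simp add: average_const)
    show "M (\<lambda>x. f (z \<otimes> x)) = M f" if f: "continuous_function f" and z: "z \<in> carrier G" for f z
    proof (rule LIMSEQ_unique[OF lim])
      show "continuous_function (\<lambda>x. f (z \<otimes> x))" by (rule continuous_function_translate[OF f z])
      have "A j (\<lambda>x. f (z \<otimes> x)) \<one> = A j f z" for j
        unfolding A_def average_def using a z by (simp add: m_comm)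
      moreover have "(\<lambda>j. A j f z - A j f \<one>) \<longlonglongrightarrow> 0"
      proof (rule LIMSEQ_I)
        fix r :: real assume "r > 0"
        then show "\<exists>no. \<forall>j\<ge>no. norm (A j f z - A j f \<one> - 0) < r"
          using flat[OF f, of "r/2"] z unfolding A_def by fastforce
      qed
      ultimately show "(\<lambda>j. A j (\<lambda>x. f (z \<otimes> x)) \<one>) \<longlonglongrightarrow> M f"
        using tendsto_add[OF _ lim[OF f]] by fastforce
    qed
    show "M (\<lambda>x. cnj (f x)) = cnj (M f)" if "continuous_function f" for f
    proof (rule LIMSEQ_unique[OF lim])
      show "continuous_function (\<lambda>x. cnj (f x))" by (intro continuous_function_cnj that)
      show "(\<lambda>j. A j (\<lambda>x. cnj (f x)) \<one>) \<longlonglongrightarrow> cnj (M f)"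
        using tendsto_cnj[OF lim, OF that] by (simp add: A_def average_def)
    qed
    show "norm (M f) \<le> Re (M F)" if fF: "continuous_function f" "continuous_function F"
      and le: "\<And>x. x \<in> carrier G \<Longrightarrow> norm (f x) \<le> Re (F x)" for f F
    proof (rule LIMSEQ_le)
      show "(\<lambda>j. norm (A j f \<one>)) \<longlonglongrightarrow> norm (M f)" by (intro tendsto_norm lim fF)
      show "(\<lambda>j. Re (A j F \<one>)) \<longlonglongrightarrow> Re (M F)" by (intro tendsto_Re lim fF)
      have "norm (A j f \<one>) \<le> Re (A j F \<one>)" for j
      proof -
        have "norm (\<Sum>i<n j. f (a j i \<otimes> \<one>)) \<le> (\<Sum>i<n j. Re (F (a j i \<otimes> \<one>)))"
          using a le by (intro sum_norm_le) auto
        then show ?thesis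
          using n[of j] unfolding A_def average_def
          by (simp add: norm_divide divide_right_mono)
      qed
      then show "\<exists>N. \<forall>j\<ge>N. norm (A j f \<one>) \<le> Re (A j F \<one>)" by blast
    qed
  qed
  then show ?thesis by blast
qed

end

section \<open>Mean squares and correlations\<close>

context compact_metrizable_abelian_group
begin

text \<open>
  Ascoli's theorem: a diagonal argument gives convergence on a dense sequence, and equicontinuity
  makes it uniform, since finitely many translates of a small neighbourhood cover the group.
\<close>

lemma equicontinuous_subsequence:
  assumes bound: "\<And>n x. x \<in> carrier G \<Longrightarrow> norm (h n x) \<le> B"
    and equi: "\<And>\<epsilon>. \<epsilon> > 0 \<Longrightarrow> \<exists>U. openin T U \<and> \<one> \<in> U \<and>
      (\<forall>n. \<forall>v\<in>U. \<forall>x\<in>carrier G. norm (h n (v \<otimes> x) - h n x) \<le> \<epsilon>)"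
  obtains k :: "nat \<Rightarrow> nat" and l :: "'a \<Rightarrow> complex"
  where "strict_mono k" "continuous_function l"
    "uniform_limit (carrier G) (\<lambda>n. h (k n)) l sequentially"
proof -
  obtain e :: "nat \<Rightarrow> 'a" where e: "\<And>i. e i \<in> carrier G" "T closure_of range e = carrier G"
    using dense_sequence by blast
  have dense_bound: "norm (h n x) \<le> B" if "x \<in> range e" for n x
    using that bound e(1) by blast
  have "countable (range e)" by simp
  obtain k :: "nat \<Rightarrow> nat" where k: "strict_mono k"
    "\<And>x. x \<in> range e \<Longrightarrow> \<exists>l. (\<lambda>n. h (k n) x) \<longlonglongrightarrow> l"
    by (rule function_convergent_subsequence[of "range e" h B, OF \<open>countable (range e)\<close> dense_bound]) auto
  have "uniformly_Cauchy_on (carrier G) (\<lambda>n. h (k n))"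
  proof (rule uniformly_Cauchy_onI)
    fix \<epsilon> :: real assume \<epsilon>: "\<epsilon> > 0"
    then obtain U where U: "openin T U" "\<one> \<in> U"
      "\<And>n v x. \<lbrakk>v \<in> U; x \<in> carrier G\<rbrakk> \<Longrightarrow> norm (h n (v \<otimes> x) - h n x) \<le> \<epsilon>/4"
      using equi[of "\<epsilon>/4"] by auto
    obtain F where F: "finite F" "F \<subseteq> range e" "\<And>x. x \<in> carrier G \<Longrightarrow> \<exists>a\<in>F. \<exists>v\<in>U. x = v \<otimes> a"
      using finite_translates_cover[OF U(1,2) _ e(2)] e(1) by blast
    obtain l where l: "\<And>a. a \<in> F \<Longrightarrow> (\<lambda>n. h (k n) a) \<longlonglongrightarrow> l a"
      using k(2) F(2) by (metis subsetD)
    have "\<forall>\<^sub>F n in sequentially. \<forall>a\<in>F. dist (h (k n) a) (l a) < \<epsilon>/8"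
      using l \<epsilon> by (intro eventually_ball_finite[OF F(1)] ballI tendstoD) auto
    then obtain N where N: "\<And>n a. \<lbrakk>n \<ge> N; a \<in> F\<rbrakk> \<Longrightarrow> dist (h (k n) a) (l a) < \<epsilon>/8"
      unfolding eventually_sequentially by blast
    have "dist (h (k m) x) (h (k n) x) < \<epsilon>" if x: "x \<in> carrier G" and mn: "m \<ge> N" "n \<ge> N" for x m n
    proof -
      obtain a v where a: "a \<in> F" "v \<in> U" "x = v \<otimes> a" using F(3)[OF x] by blast
      have aG: "a \<in> carrier G" using a F e by auto
      have 1: "dist (h j x) (h j a) \<le> \<epsilon>/4" for j
        using U(3)[OF a(2) aG] a(3) by (simp add: dist_norm)
      have 2: "dist (h (k m) a) (h (k n) a) < \<epsilon>/4"
        using dist_triangle_less_add[OF N[OF mn(1) a(1)], of "h (k n) a" "\<epsilon>/8"] N[OF mn(2) a(1)]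
        by (simp add: dist_commute)
      have "dist (h (k m) x) (h (k n) x) \<le> dist (h (k m) x) (h (k m) a) + dist (h (k m) a) (h (k n) x)"
        by (rule dist_triangle)
      also have "dist (h (k m) a) (h (k n) x) \<le> dist (h (k m) a) (h (k n) a) + dist (h (k n) a) (h (k n) x)"
        by (rule dist_triangle)
      finally show ?thesis using 1[of "k m"] 1[of "k n"] 2 \<epsilon> by (simp add: dist_commute)
    qed
    then show "\<exists>M. \<forall>x\<in>carrier G. \<forall>m\<ge>M. \<forall>n\<ge>M. dist (h (k m) x) (h (k n) x) < \<epsilon>" by blast
  qed
  then obtain l where l: "uniform_limit (carrier G) (\<lambda>n. h (k n)) l sequentially"
    using Cauchy_uniformly_convergent unfolding uniformly_convergent_on_def by blast
  have "continuous_function l"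
  proof (rule continuous_function_if_increments_small)
    fix \<epsilon> :: real assume "\<epsilon> > 0"
    then obtain U where U: "openin T U" "\<one> \<in> U"
      "\<And>n v x. \<lbrakk>v \<in> U; x \<in> carrier G\<rbrakk> \<Longrightarrow> norm (h n (v \<otimes> x) - h n x) \<le> \<epsilon>"
      using equi[of \<epsilon>] by auto
    have UG: "U \<subseteq> carrier G" using openin_subset[OF U(1)] by (simp add: topspace_eq_carrier)
    have "norm (l (v \<otimes> x) - l x) \<le> \<epsilon>" if v: "v \<in> U" and x: "x \<in> carrier G" for v x
    proof (rule LIMSEQ_le_const2)
      have "v \<otimes> x \<in> carrier G" using v x UG by auto
      then show "(\<lambda>n. norm (h (k n) (v \<otimes> x) - h (k n) x)) \<longlonglongrightarrow> norm (l (v \<otimes> x) - l x)"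
        using x by (intro tendsto_intros tendsto_uniform_limitI[OF l])
    qed (use U(3)[OF v x] in blast)
    with U(1,2) show "\<exists>U. openin T U \<and> \<one> \<in> U \<and> (\<forall>v\<in>U. \<forall>x\<in>carrier G. norm (l (v \<otimes> x) - l x) \<le> \<epsilon>)"
      by (intro exI[of _ U]) simp
  qed
  with k l that show thesis by blast
qed

end

context invariant_mean
begin

lemma mean_const: "M (\<lambda>x. c) = c"
  using mean_cmult[of "\<lambda>x. 1" c] mean_one by simp

lemma mean_diff:
  assumes "continuous_function f" "continuous_function g"
  shows "M (\<lambda>x. f x - g x) = M f - M g"
  using mean_add[of f "\<lambda>x. (-1) * g x"] mean_cmult[of g "-1"] assms
    continuous_function_cmult[of g "-1"] by simp

lemma norm_mean_le_const:
  assumes "continuous_function f" "\<And>x. x \<in> carrier G \<Longrightarrow> norm (f x) \<le> B"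
  shows "norm (M f) \<le> B"
  using norm_mean_le[OF assms(1), of "\<lambda>x. of_real B"] assms(2) by (simp add: mean_const)

lemma mean_cong:
  assumes "continuous_function f" "\<And>x. x \<in> carrier G \<Longrightarrow> f x = g x"
  shows "M f = M g"
proof -
  have g: "continuous_function g" by (rule continuous_function_cong[OF assms])
  have "norm (M (\<lambda>x. f x - g x)) \<le> 0"
    using assms g by (intro norm_mean_le_const continuous_map_diff) auto
  then show ?thesis using mean_diff[OF assms(1) g] by simp
qed

lemma mean_sum:
  assumes "finite I" "\<And>i. i \<in> I \<Longrightarrow> continuous_function (f i)"
  shows "M (\<lambda>x. \<Sum>i\<in>I. f i x) = (\<Sum>i\<in>I. M (f i))"
  using assms
proof (induction I rule: finite_induct)
  case (insert i I)
  have "continuous_function (\<lambda>x. \<Sum>i\<in>I. f i x)"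
    using insert by (intro continuous_map_sum) auto
  with insert show ?case by (simp add: mean_add)
qed (simp add: mean_const)

lemma mean_tendsto:
  assumes "\<And>n. continuous_function (f n)" "continuous_function l"
    and lim: "uniform_limit (carrier G) f l sequentially"
  shows "(\<lambda>n. M (f n)) \<longlonglongrightarrow> M l"
proof (rule LIMSEQ_I)
  fix r :: real assume "r > 0"
  then obtain N where N: "\<And>n x. \<lbrakk>n \<ge> N; x \<in> carrier G\<rbrakk> \<Longrightarrow> dist (f n x) (l x) < r/2"
    using uniform_limitD[OF lim, of "r/2"] unfolding eventually_sequentially by auto
  have "norm (M (f n) - M l) < r" if "n \<ge> N" for n
  proof -
    have "norm (M (\<lambda>x. f n x - l x)) \<le> r/2"
      using assms N[OF that] by (intro norm_mean_le_const continuous_map_diff) (auto simp: dist_norm intro: less_imp_le)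
    then show ?thesis using mean_diff[OF assms(1) assms(2), of n] \<open>r > 0\<close> by simp
  qed
  then show "\<exists>no. \<forall>n\<ge>no. norm (M (f n) - M l) < r" by blast
qed

definition inner_mean :: "('a \<Rightarrow> complex) \<Rightarrow> ('a \<Rightarrow> complex) \<Rightarrow> complex" where
  "inner_mean f g = M (\<lambda>x. f x * cnj (g x))"

definition mean_square :: "('a \<Rightarrow> complex) \<Rightarrow> real" where
  "mean_square f = Re (inner_mean f f)"

lemma inner_mean_cnj:
  assumes "continuous_function f" "continuous_function g"
  shows "inner_mean g f = cnj (inner_mean f g)"
proof -
  have "cnj (inner_mean f g) = M (\<lambda>x. cnj (f x * cnj (g x)))"
    unfolding inner_mean_def using assms by (intro mean_cnj[symmetric] continuous_function_intros)
  then show ?thesis by (simp add: inner_mean_def mult.commute)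
qed

lemma inner_mean_self:
  assumes "continuous_function f"
  shows "inner_mean f f = of_real (mean_square f)"
  using inner_mean_cnj[OF assms assms] unfolding mean_square_def
  by (metis Reals_cnj_iff of_real_Re)

lemma mean_square_nonneg:
  assumes "continuous_function f"
  shows "mean_square f \<ge> 0"
proof -
  have "norm (M (\<lambda>x. 0)) \<le> Re (M (\<lambda>x. f x * cnj (f x)))"
  proof (rule norm_mean_le[OF continuous_function_const])
    show "continuous_function (\<lambda>x. f x * cnj (f x))"
      using assms by (intro continuous_function_intros)
  qed (simp add: complex_norm_square[symmetric])
  then show ?thesis by (simp add: mean_const mean_square_def inner_mean_def)
qed

lemma mean_square_add:
  assumes f: "continuous_function f" and g: "continuous_function g"
  shows "mean_square (\<lambda>x. f x + g x) = mean_square f + 2 * Re (inner_mean f g) + mean_square g"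
proof -
  have "inner_mean (\<lambda>x. f x + g x) (\<lambda>x. f x + g x)
      = M (\<lambda>x. (f x * cnj (f x) + f x * cnj (g x)) + (g x * cnj (f x) + g x * cnj (g x)))"
    unfolding inner_mean_def by (simp add: algebra_simps)
  also have "\<dots> = (inner_mean f f + inner_mean f g) + (inner_mean g f + inner_mean g g)"
    unfolding inner_mean_def using f g by (simp add: mean_add continuous_function_intros)
  finally show ?thesis
    unfolding mean_square_def using inner_mean_cnj[OF f g] by simp
qed

lemma inner_mean_cmult_right:
  assumes "continuous_function f" "continuous_function g"
  shows "inner_mean f (\<lambda>x. c * g x) = cnj c * inner_mean f g"
proof -
  have "inner_mean f (\<lambda>x. c * g x) = M (\<lambda>x. cnj c * (f x * cnj (g x)))"
    unfolding inner_mean_def by (simp add: mult_ac)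
  also have "\<dots> = cnj c * inner_mean f g"
    unfolding inner_mean_def using assms by (intro mean_cmult continuous_function_intros)
  finally show ?thesis .
qed

lemma mean_square_cmult:
  assumes "continuous_function f"
  shows "mean_square (\<lambda>x. c * f x) = (norm c)\<^sup>2 * mean_square f"
proof -
  have "inner_mean (\<lambda>x. c * f x) (\<lambda>x. c * f x) = M (\<lambda>x. of_real ((norm c)\<^sup>2) * (f x * cnj (f x)))"
    unfolding inner_mean_def complex_norm_square by (simp add: mult_ac)
  also have "\<dots> = of_real ((norm c)\<^sup>2) * inner_mean f f"
    unfolding inner_mean_def using assms by (intro mean_cmult continuous_function_intros)
  finally show ?thesis unfolding mean_square_def by simp
qed

lemma mean_square_translate:
  assumes "continuous_function f" "z \<in> carrier G"
  shows "mean_square (\<lambda>x. f (z \<otimes> x)) = mean_square f"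
  using mean_translate[of "\<lambda>x. f x * cnj (f x)" z] assms
  by (simp add: mean_square_def inner_mean_def continuous_function_intros)

lemma mean_square_cong:
  assumes "continuous_function f" "\<And>x. x \<in> carrier G \<Longrightarrow> f x = g x"
  shows "mean_square f = mean_square g"
proof -
  have "M (\<lambda>x. f x * cnj (f x)) = M (\<lambda>x. g x * cnj (g x))"
    using assms by (intro mean_cong continuous_function_intros) auto
  then show ?thesis by (simp add: mean_square_def inner_mean_def)
qed

text \<open>
  Faithfulness of the mean: if \<open>f x0 \<noteq> 0\<close>, finitely many translates of a
  neighbourhood of \<open>x0\<close> on which \<open>f\<close> is bounded away from zero cover the
  group, so the sum of the corresponding translates of \<open>f * cnj f\<close> has a positive lower
  bound, while its mean is a multiple of that of \<open>f * cnj f\<close>.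
\<close>

lemma mean_square_eq_0D:
  assumes f: "continuous_function f" and 0: "mean_square f = 0" and x0: "x0 \<in> carrier G"
  shows "f x0 = 0"
proof (rule ccontr)
  assume nz: "f x0 \<noteq> 0"
  define g where "g x = f x * cnj (f x)" for x
  have g: "continuous_function g" unfolding g_def using f by (intro continuous_function_intros)
  have norm_g: "norm (g x) = Re (g x)" for x
    unfolding g_def complex_norm_square[symmetric] by (simp add: norm_power)
  define \<epsilon> where "\<epsilon> = Re (g x0) / 2"
  have \<epsilon>: "\<epsilon> > 0" unfolding \<epsilon>_def norm_g[symmetric] using nz by (simp add: g_def)
  obtain U where U: "openin T U" "\<one> \<in> U"
    "\<And>v x. \<lbrakk>v \<in> U; x \<in> carrier G\<rbrakk> \<Longrightarrow> norm (g (v \<otimes> x) - g x) < \<epsilon>"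
    using increments_small[OF g \<epsilon>] by blast
  have UG: "U \<subseteq> carrier G" using openin_subset[OF U(1)] by (simp add: topspace_eq_carrier)
  have dense: "T closure_of carrier G = carrier G"
    using closure_of_topspace[of T] by (simp add: topspace_eq_carrier)
  obtain F where F: "finite F" "F \<subseteq> carrier G" "\<And>x. x \<in> carrier G \<Longrightarrow> \<exists>a\<in>F. \<exists>v\<in>U. x = v \<otimes> a"
    by (rule finite_translates_cover[OF U(1,2) subset_refl dense]) blast
  have low: "\<epsilon> \<le> Re (\<Sum>a\<in>F. g (a \<otimes> x))" if x: "x \<in> carrier G" for x
  proof -
    have "x0 \<otimes> inv x \<in> carrier G" using x x0 by simp
    then obtain a v where a: "a \<in> F" "v \<in> U" "x0 \<otimes> inv x = v \<otimes> a" using F(3) by blast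
    have aG: "a \<in> carrier G" and vG: "v \<in> carrier G" using a F UG by auto
    have "x0 = (x0 \<otimes> inv x) \<otimes> x" using x x0 by (simp add: m_assoc)
    also have "\<dots> = v \<otimes> (a \<otimes> x)" using a(3) x aG vG by (simp add: m_assoc)
    finally have "norm (g x0 - g (a \<otimes> x)) < \<epsilon>" using U(3)[OF a(2), of "a \<otimes> x"] aG x by simp
    then have "\<epsilon> \<le> Re (g (a \<otimes> x))"
      using norm_triangle_ineq2[of "g x0" "g (a \<otimes> x)"] unfolding \<epsilon>_def norm_g by simp
    also have "\<dots> \<le> (\<Sum>a\<in>F. Re (g (a \<otimes> x)))"
      using F(1) a(1) by (intro member_le_sum) (auto simp: norm_g[symmetric])
    finally show ?thesis by simp
  qed
  have "norm (M (\<lambda>x. of_real \<epsilon>)) \<le> Re (M (\<lambda>x. \<Sum>a\<in>F. g (a \<otimes> x)))"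
  proof (rule norm_mean_le[OF continuous_function_const])
    show "continuous_function (\<lambda>x. \<Sum>a\<in>F. g (a \<otimes> x))"
      using F(1,2) g by (intro continuous_map_sum continuous_function_translate) auto
  qed (use low \<epsilon> in auto)
  also have "M (\<lambda>x. \<Sum>a\<in>F. g (a \<otimes> x)) = (\<Sum>a\<in>F. M g)"
  proof (subst mean_sum[OF F(1)])
    show "continuous_function (\<lambda>x. g (a \<otimes> x))" if "a \<in> F" for a
      using that F(2) g by (intro continuous_function_translate) auto
    show "(\<Sum>a\<in>F. M (\<lambda>x. g (a \<otimes> x))) = (\<Sum>a\<in>F. M g)"
      using F(2) g by (intro sum.cong mean_translate) auto
  qed
  also have "Re (M g) = 0" using 0 unfolding mean_square_def inner_mean_def g_def by simp
  then have "Re (\<Sum>a\<in>F. M g) = 0" by simp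
  finally show False using \<epsilon> by (simp add: mean_const)
qed

text \<open>
  The inequality \<open>\<bar>g\<bar> \<le> (1 + \<bar>g\<bar>\<^sup>2) / 2\<close> bounds the mean
  by means of the mean square; a multiplicative constant is harmless in what follows.
\<close>

lemma norm_mean_mult_le:
  assumes p: "continuous_function p" and g: "continuous_function g"
    and B: "\<And>x. x \<in> carrier G \<Longrightarrow> norm (p x) \<le> B"
  shows "norm (M (\<lambda>x. p x * g x)) \<le> B * (1 + mean_square g) / 2"
proof -
  define F where "F x = of_real (B/2) * (1 + g x * cnj (g x))" for x
  have gg: "continuous_function (\<lambda>x. 1 + g x * cnj (g x))"
    using g by (intro continuous_map_add continuous_function_const continuous_function_mult continuous_function_cnj)
  have F: "continuous_function F" unfolding F_def by (intro continuous_function_cmult gg)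
  have "norm (p x * g x) \<le> Re (F x)" if x: "x \<in> carrier G" for x
  proof -
    have "norm (g x) \<le> (1 + (norm (g x))\<^sup>2) / 2"
      using zero_le_power2[of "norm (g x) - 1"] by (simp add: power2_eq_square algebra_simps)
    moreover have "0 \<le> B" using B[OF x] order_trans[OF norm_ge_zero] by blast
    ultimately have "norm (p x) * norm (g x) \<le> B * ((1 + (norm (g x))\<^sup>2) / 2)"
      using B[OF x] by (intro mult_mono) auto
    then show ?thesis by (simp add: F_def norm_mult complex_norm_square[symmetric])
  qed
  then have "norm (M (\<lambda>x. p x * g x)) \<le> Re (M F)"
    using p g F by (intro norm_mean_le continuous_function_mult)
  also have "M F = of_real (B/2) * M (\<lambda>x. 1 + g x * cnj (g x))"
    unfolding F_def by (rule mean_cmult[OF gg])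
  also have "M (\<lambda>x. 1 + g x * cnj (g x)) = 1 + inner_mean g g"
    using g mean_add[OF continuous_function_const continuous_function_mult[OF g continuous_function_cnj[OF g]], of 1]
    by (simp add: mean_one inner_mean_def)
  finally show ?thesis by (simp add: mean_square_def)
qed

text \<open>
  Up to inversion of the argument of \<open>g\<close>, this is the convolution of \<open>p\<close>
  and \<open>g\<close>.
\<close>

definition correlation :: "('a \<Rightarrow> complex) \<Rightarrow> ('a \<Rightarrow> complex) \<Rightarrow> 'a \<Rightarrow> complex" where
  "correlation p g x = M (\<lambda>y. p (x \<otimes> y) * g y)"

lemma norm_correlation_le:
  assumes "continuous_function p" "continuous_function g" "x \<in> carrier G"
    and "\<And>x. x \<in> carrier G \<Longrightarrow> norm (p x) \<le> B"
  shows "norm (correlation p g x) \<le> B * (1 + mean_square g) / 2"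
  unfolding correlation_def using assms
  by (intro norm_mean_mult_le continuous_function_translate) auto

lemma correlation_increment_le:
  assumes p: "continuous_function p" and g: "continuous_function g"
    and v: "v \<in> carrier G" and x: "x \<in> carrier G"
    and B: "\<And>y. y \<in> carrier G \<Longrightarrow> norm (p (v \<otimes> y) - p y) \<le> B"
  shows "norm (correlation p g (v \<otimes> x) - correlation p g x) \<le> B * (1 + mean_square g) / 2"
proof -
  have "correlation p g (v \<otimes> x) - correlation p g x
      = M (\<lambda>y. p ((v \<otimes> x) \<otimes> y) * g y - p (x \<otimes> y) * g y)"
    unfolding correlation_def using p g v x
    by (intro mean_diff[symmetric] continuous_function_intros) auto
  also have "\<dots> = M (\<lambda>y. (p ((v \<otimes> x) \<otimes> y) - p (x \<otimes> y)) * g y)"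
    by (simp add: algebra_simps)
  finally show ?thesis
  proof (rule ssubst[where P = "\<lambda>t. norm t \<le> _"])
    show "norm (M (\<lambda>y. (p ((v \<otimes> x) \<otimes> y) - p (x \<otimes> y)) * g y)) \<le> B * (1 + mean_square g) / 2"
      using p g v x B
      by (intro norm_mean_mult_le continuous_map_diff continuous_function_translate) (auto simp: m_assoc)
  qed
qed

text \<open>
  The modulus of continuity of \<open>correlation p g\<close> depends on \<open>g\<close> only
  through its mean square; this is the source of compactness.
\<close>

lemma correlation_equicontinuous:
  assumes p: "continuous_function p" and "\<epsilon> > 0"
  obtains U where "openin T U" "\<one> \<in> U"
    "\<And>g v x. \<lbrakk>continuous_function g; mean_square g \<le> 1; v \<in> U; x \<in> carrier G\<rbrakk> \<Longrightarrow>
      norm (correlation p g (v \<otimes> x) - correlation p g x) \<le> \<epsilon>"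
proof -
  obtain U where U: "openin T U" "\<one> \<in> U"
      "\<And>v x. \<lbrakk>v \<in> U; x \<in> carrier G\<rbrakk> \<Longrightarrow> norm (p (v \<otimes> x) - p x) < \<epsilon>"
    using increments_small[OF p \<open>\<epsilon> > 0\<close>] by blast
  show thesis
  proof (rule that[OF U(1,2)])
    fix g v x assume g: "continuous_function g" "mean_square g \<le> 1" and v: "v \<in> U" and x: "x \<in> carrier G"
    have "v \<in> carrier G" using openin_subset[OF U(1)] v by (auto simp: topspace_eq_carrier)
    then have "norm (correlation p g (v \<otimes> x) - correlation p g x) \<le> \<epsilon> * (1 + mean_square g) / 2"
      using U(3)[OF v] by (intro correlation_increment_le p g x) (auto intro: less_imp_le)
    also have "\<dots> \<le> \<epsilon>" using g(2) \<open>\<epsilon> > 0\<close> by (simp add: field_simps)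
    finally show "norm (correlation p g (v \<otimes> x) - correlation p g x) \<le> \<epsilon>" .
  qed
qed

lemma continuous_correlation:
  assumes p: "continuous_function p" and g: "continuous_function g"
  shows "continuous_function (correlation p g)"
proof (rule continuous_function_if_increments_small)
  fix \<epsilon> :: real assume "\<epsilon> > 0"
  have pos: "1 + mean_square g > 0" using mean_square_nonneg[OF g] by simp
  obtain U where U: "openin T U" "\<one> \<in> U"
      "\<And>v x. \<lbrakk>v \<in> U; x \<in> carrier G\<rbrakk> \<Longrightarrow> norm (p (v \<otimes> x) - p x) < \<epsilon> / (1 + mean_square g)"
    using increments_small[OF p, of "\<epsilon> / (1 + mean_square g)"] \<open>\<epsilon> > 0\<close> pos by auto
  have "norm (correlation p g (v \<otimes> x) - correlation p g x) \<le> \<epsilon>" if v: "v \<in> U" and x: "x \<in> carrier G" for v x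
  proof -
    have "v \<in> carrier G" using openin_subset[OF U(1)] v by (auto simp: topspace_eq_carrier)
    then have "norm (correlation p g (v \<otimes> x) - correlation p g x) \<le> \<epsilon> / (1 + mean_square g) * (1 + mean_square g) / 2"
      using U(3)[OF v] by (intro correlation_increment_le p g x) (auto intro: less_imp_le)
    also have "\<dots> \<le> \<epsilon>" using pos \<open>\<epsilon> > 0\<close> by simp
    finally show ?thesis .
  qed
  with U(1,2) show "\<exists>U. openin T U \<and> \<one> \<in> U \<and>
      (\<forall>v\<in>U. \<forall>x\<in>carrier G. norm (correlation p g (v \<otimes> x) - correlation p g x) \<le> \<epsilon>)"
    by (intro exI[of _ U]) simp
qed

text \<open>
  The Fourier coefficients of the autocorrelation are the squared absolute values of those of
  \<open>h\<close>; it is the basic example of a function of positive type.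
\<close>

definition autocorrelation :: "('a \<Rightarrow> complex) \<Rightarrow> 'a \<Rightarrow> complex" where
  "autocorrelation h = correlation h (\<lambda>y. cnj (h y))"

lemma autocorrelation_altdef: "autocorrelation h x = inner_mean (\<lambda>y. h (x \<otimes> y)) h"
  unfolding autocorrelation_def correlation_def inner_mean_def ..

lemma autocorrelation_cong:
  assumes h: "continuous_function h" and eq: "\<And>y. y \<in> carrier G \<Longrightarrow> h y = h' y"
    and x: "x \<in> carrier G"
  shows "autocorrelation h x = autocorrelation h' x"
  unfolding autocorrelation_altdef inner_mean_def
proof (rule mean_cong)
  show "continuous_function (\<lambda>y. h (x \<otimes> y) * cnj (h y))"
    using h x by (intro continuous_function_intros)
qed (use x eq in simp)

lemma continuous_autocorrelation:
  "continuous_function h \<Longrightarrow> continuous_function (autocorrelation h)"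
  unfolding autocorrelation_def by (intro continuous_correlation continuous_function_cnj)

lemma autocorrelation_one:
  assumes "continuous_function h"
  shows "autocorrelation h \<one> = of_real (mean_square h)"
proof -
  have "autocorrelation h \<one> = inner_mean h h"
    unfolding autocorrelation_def correlation_def inner_mean_def
    using assms by (intro mean_cong continuous_function_intros) auto
  then show ?thesis by (simp add: inner_mean_self assms)
qed

lemma autocorrelation_inv:
  assumes h: "continuous_function h" and x: "x \<in> carrier G"
  shows "autocorrelation h (inv x) = cnj (autocorrelation h x)"
proof -
  have "autocorrelation h (inv x) = M (\<lambda>y. h (inv x \<otimes> (x \<otimes> y)) * cnj (h (x \<otimes> y)))"
    unfolding autocorrelation_def correlation_def
    using mean_translate[of "\<lambda>y. h (inv x \<otimes> y) * cnj (h y)" x] h x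
    by (simp add: continuous_function_intros)
  also have "\<dots> = M (\<lambda>y. h y * cnj (h (x \<otimes> y)))"
  proof (rule mean_cong[symmetric])
    show "continuous_function (\<lambda>y. h y * cnj (h (x \<otimes> y)))"
      using h x by (intro continuous_function_intros)
  qed (use x in \<open>simp add: m_assoc[symmetric]\<close>)
  also have "\<dots> = cnj (autocorrelation h x)"
    unfolding autocorrelation_altdef inner_mean_def using h x
    by (subst mean_cnj[symmetric]) (auto intro!: continuous_function_intros simp: mult.commute)
  finally show ?thesis .
qed

lemma inner_mean_tendsto:
  assumes f: "\<And>n. continuous_function (f n)" "continuous_function l"
      "uniform_limit (carrier G) f l sequentially"
    and g: "\<And>n. continuous_function (g n)" "continuous_function m"
      "uniform_limit (carrier G) g m sequentially"
  shows "(\<lambda>n. inner_mean (f n) (g n)) \<longlonglongrightarrow> inner_mean l m"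
proof -
  have bdd: "bounded (q ` carrier G)" if "continuous_function q" for q
    using continuous_function_bounded[OF that] unfolding bounded_iff by (metis imageE)
  have cnj_lim: "uniform_limit (carrier G) (\<lambda>n x. cnj (g n x)) (\<lambda>x. cnj (m x)) sequentially"
    using g(3) unfolding uniform_limit_iff dist_norm complex_cnj_diff[symmetric] complex_mod_cnj .
  have bc: "continuous_function (\<lambda>x. cnj (m x))" by (intro continuous_function_cnj g)
  show ?thesis
    unfolding inner_mean_def using f g bdd[OF f(2)] bdd[OF bc] cnj_lim
    by (intro mean_tendsto continuous_function_intros uniform_lim_mult)
qed

lemma mean_square_tendsto:
  assumes "\<And>n. continuous_function (f n)" "continuous_function l"
      "uniform_limit (carrier G) f l sequentially"
  shows "(\<lambda>n. mean_square (f n)) \<longlonglongrightarrow> mean_square l"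
  unfolding mean_square_def by (intro tendsto_Re inner_mean_tendsto assms)

lemma uniform_limit_translate:
  assumes "uniform_limit (carrier G) f l sequentially" "z \<in> carrier G"
  shows "uniform_limit (carrier G) (\<lambda>n x. f n (z \<otimes> x)) (\<lambda>x. l (z \<otimes> x)) sequentially"
proof (rule uniform_limitI)
  fix e :: real assume "e > 0"
  from uniform_limitD[OF assms(1) this]
  show "\<forall>\<^sub>F n in sequentially. \<forall>x\<in>carrier G. dist (f n (z \<otimes> x)) (l (z \<otimes> x)) < e"
    by (rule eventually_mono) (use assms(2) in auto)
qed

lemma mean_square_le:
  assumes "continuous_function f" "\<And>x. x \<in> carrier G \<Longrightarrow> norm (f x) \<le> B"
  shows "mean_square f \<le> B\<^sup>2"
proof -
  have "norm (inner_mean f f) \<le> B\<^sup>2"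
    unfolding inner_mean_def
  proof (rule norm_mean_le_const)
    show "continuous_function (\<lambda>x. f x * cnj (f x))" using assms(1) by (intro continuous_function_intros)
    show "norm (f x * cnj (f x)) \<le> B\<^sup>2" if "x \<in> carrier G" for x
      using assms(2)[OF that] unfolding norm_mult complex_mod_cnj power2_eq_square[symmetric]
      by (intro power_mono) auto
  qed
  then show ?thesis unfolding mean_square_def using complex_Re_le_cmod order_trans by blast
qed

lemma autocorrelation_uniform_limit:
  assumes h: "\<And>n. continuous_function (h n)" and l: "continuous_function l"
    and bound: "\<And>n x. x \<in> carrier G \<Longrightarrow> norm (h n x) \<le> B"
    and lim: "uniform_limit (carrier G) h l sequentially"
  shows "uniform_limit (carrier G) (\<lambda>n. autocorrelation (h n)) (autocorrelation l) sequentially"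
proof (rule uniform_limitI)
  fix \<epsilon> :: real assume \<epsilon>: "\<epsilon> > 0"
  define C where "C = max B 1"
  have C: "C > 0" "\<And>n x. x \<in> carrier G \<Longrightarrow> norm (h n x) \<le> C"
    unfolding C_def using bound by (auto intro: max.coboundedI1)
  have lC: "norm (l x) \<le> C" if "x \<in> carrier G" for x
    using C(2)[OF that] tendsto_norm[OF tendsto_uniform_limitI[OF lim that]]
    by (intro LIMSEQ_le_const2) auto
  define \<eta> where "\<eta> = \<epsilon> / (4 * C)"
  have "\<eta> > 0" unfolding \<eta>_def using \<epsilon> C by simp
  show "\<forall>\<^sub>F n in sequentially. \<forall>x\<in>carrier G. dist (autocorrelation (h n) x) (autocorrelation l x) < \<epsilon>"
    using uniform_limitD[OF lim \<open>\<eta> > 0\<close>]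
  proof (rule eventually_mono)
    fix n assume close: "\<forall>x\<in>carrier G. dist (h n x) (l x) < \<eta>"
    show "\<forall>x\<in>carrier G. dist (autocorrelation (h n) x) (autocorrelation l x) < \<epsilon>"
    proof
      fix x assume x: "x \<in> carrier G"
      have "norm (h n (x \<otimes> y) * cnj (h n y) - l (x \<otimes> y) * cnj (l y)) \<le> \<eta> * C + C * \<eta>"
        if y: "y \<in> carrier G" for y
      proof -
        have "h n (x \<otimes> y) * cnj (h n y) - l (x \<otimes> y) * cnj (l y)
            = (h n (x \<otimes> y) - l (x \<otimes> y)) * cnj (h n y) + l (x \<otimes> y) * cnj (h n y - l y)"
          by (simp add: algebra_simps)
        also have "norm \<dots> \<le> norm (h n (x \<otimes> y) - l (x \<otimes> y)) * norm (h n y) + norm (l (x \<otimes> y)) * norm (h n y - l y)"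
          by (rule order_trans[OF norm_triangle_ineq]) (simp only: norm_mult complex_mod_cnj order_refl)
        also have "\<dots> \<le> \<eta> * C + C * \<eta>"
          using close x y C lC \<open>\<eta> > 0\<close>
          by (intro add_mono mult_mono) (auto simp: dist_norm intro!: less_imp_le)
        finally show ?thesis .
      qed
      then have "norm (M (\<lambda>y. h n (x \<otimes> y) * cnj (h n y) - l (x \<otimes> y) * cnj (l y))) \<le> \<eta> * C + C * \<eta>"
        using h l x by (intro norm_mean_le_const continuous_function_intros)
      also have "M (\<lambda>y. h n (x \<otimes> y) * cnj (h n y) - l (x \<otimes> y) * cnj (l y))
          = autocorrelation (h n) x - autocorrelation l x"
        unfolding autocorrelation_def correlation_def
        using h l x by (intro mean_diff continuous_function_intros)
      also have "\<eta> * C + C * \<eta> = \<epsilon>/2" using C by (simp add: \<eta>_def)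
      finally show "dist (autocorrelation (h n) x) (autocorrelation l x) < \<epsilon>"
        using \<epsilon> by (simp add: dist_norm)
    qed
  qed
qed

end

section \<open>An extremal problem\<close>

context invariant_mean
begin

text \<open>
  The extremal problem below is perturbed in the directions \<open>y \<mapsto> c * g (z \<otimes>
  y)\<close> with \<open>\<bar>c\<bar> = 1\<close>, functions whose Fourier coefficients have the
  same absolute values as those of \<open>g\<close>. This lemma and the next two compute the effect
  on the mean square, on correlations and on autocorrelations.
\<close>

lemma mean_square_add_modulated_translate:
  assumes g: "continuous_function g" and z: "z \<in> carrier G" and c: "norm c = 1"
  shows "mean_square (\<lambda>y. g y + c * g (z \<otimes> y))
    = 2 * (mean_square g + Re (c * autocorrelation g z))"
proof -
  have gz: "continuous_function (\<lambda>y. g (z \<otimes> y))" by (rule continuous_function_translate[OF g z])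
  have "inner_mean g (\<lambda>y. c * g (z \<otimes> y)) = cnj (c * autocorrelation g z)"
    using inner_mean_cmult_right[OF g gz, of c] inner_mean_cnj[OF gz g]
    by (simp add: autocorrelation_altdef)
  then show ?thesis
    using mean_square_add[OF g continuous_function_cmult[OF gz, of c]] c
      mean_square_cmult[OF gz, of c] mean_square_translate[OF g z] by simp
qed

lemma correlation_add_modulated_translate:
  assumes p: "continuous_function p" and g: "continuous_function g"
    and z: "z \<in> carrier G" and x: "x \<in> carrier G"
  shows "correlation p (\<lambda>y. g y + c * g (z \<otimes> y)) x
    = correlation p g x + c * correlation p g (inv z \<otimes> x)"
proof -
  have c1: "continuous_function (\<lambda>y. p (x \<otimes> y) * g y)"
    and c2: "continuous_function (\<lambda>y. p (x \<otimes> y) * g (z \<otimes> y))"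
    and c3: "continuous_function (\<lambda>y. p (inv z \<otimes> x \<otimes> y) * g y)"
    using p g z x by (intro continuous_function_intros; simp)+
  have "correlation p (\<lambda>y. g y + c * g (z \<otimes> y)) x
      = M (\<lambda>y. p (x \<otimes> y) * g y + c * (p (x \<otimes> y) * g (z \<otimes> y)))"
    unfolding correlation_def by (simp add: algebra_simps)
  also have "\<dots> = correlation p g x + c * M (\<lambda>y. p (x \<otimes> y) * g (z \<otimes> y))"
    unfolding correlation_def using c1 c2 by (simp add: mean_add mean_cmult continuous_function_cmult)
  also have "M (\<lambda>y. p (x \<otimes> y) * g (z \<otimes> y)) = M (\<lambda>y. p (inv z \<otimes> x \<otimes> (z \<otimes> y)) * g (z \<otimes> y))"
  proof (rule mean_cong[OF c2])
    fix y assume y: "y \<in> carrier G"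
    have "inv z \<otimes> x \<otimes> (z \<otimes> y) = (z \<otimes> inv z) \<otimes> (x \<otimes> y)"
      using x y z by (simp only: m_ac inv_closed m_closed)
    then show "p (x \<otimes> y) * g (z \<otimes> y) = p (inv z \<otimes> x \<otimes> (z \<otimes> y)) * g (z \<otimes> y)"
      using x y z by simp
  qed
  also have "\<dots> = correlation p g (inv z \<otimes> x)"
    unfolding correlation_def using mean_translate[OF c3 z] .
  finally show ?thesis .
qed

lemma autocorrelation_add_modulated_translate:
  assumes h: "continuous_function h" and z: "z \<in> carrier G" and x: "x \<in> carrier G" and c: "norm c = 1"
  shows "autocorrelation (\<lambda>x. h x + c * h (inv z \<otimes> x)) x
    = 2 * autocorrelation h x + (c * autocorrelation h (inv z \<otimes> x) + cnj c * autocorrelation h (z \<otimes> x))"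
proof -
  have cc: "c * cnj c = 1" using c by (simp add: complex_norm_square[symmetric])
  have iz: "inv z \<in> carrier G" using z by simp
  let ?q = "\<lambda>y. cnj (h y)"
  have q: "continuous_function ?q" by (intro continuous_function_cnj h)
  have hi: "continuous_function (\<lambda>y. h (inv z \<otimes> y))" by (rule continuous_function_translate[OF h iz])
  \<comment> \<open>Expand the second factor by the preceding lemma, then the first factor by linearity.\<close>
  have lin: "correlation (\<lambda>x. h x + c * h (inv z \<otimes> x)) ?q w
      = autocorrelation h w + c * autocorrelation h (inv z \<otimes> w)" if w: "w \<in> carrier G" for w
  proof -
    have c1: "continuous_function (\<lambda>y. h (w \<otimes> y) * ?q y)"
      and c2: "continuous_function (\<lambda>y. h (inv z \<otimes> (w \<otimes> y)) * ?q y)"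
      using h q w iz hi continuous_function_translate[OF hi w]
      by (auto intro!: continuous_function_mult continuous_function_translate)
    have "correlation (\<lambda>x. h x + c * h (inv z \<otimes> x)) ?q w
        = M (\<lambda>y. h (w \<otimes> y) * ?q y + c * (h (inv z \<otimes> (w \<otimes> y)) * ?q y))"
      unfolding correlation_def by (simp add: algebra_simps)
    also have "\<dots> = autocorrelation h w + c * M (\<lambda>y. h (inv z \<otimes> (w \<otimes> y)) * ?q y)"
      unfolding autocorrelation_def correlation_def using c1 c2
      by (simp add: mean_add mean_cmult continuous_function_cmult)
    also have "M (\<lambda>y. h (inv z \<otimes> (w \<otimes> y)) * ?q y) = autocorrelation h (inv z \<otimes> w)"
      unfolding autocorrelation_def correlation_def using iz w
      by (intro mean_cong[OF c2]) (simp add: m_assoc)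
    finally show ?thesis .
  qed
  let ?h = "\<lambda>x. h x + c * h (inv z \<otimes> x)"
  have "continuous_function ?h" using h hi by (intro continuous_map_add continuous_function_cmult)
  from correlation_add_modulated_translate[OF this q iz x, of "cnj c"]
  have "autocorrelation ?h x = correlation ?h ?q x + cnj c * correlation ?h ?q (z \<otimes> x)"
    unfolding autocorrelation_def using z by simp
  also have "\<dots> = autocorrelation h x + c * autocorrelation h (inv z \<otimes> x)
      + (cnj c * autocorrelation h (z \<otimes> x) + (c * cnj c) * autocorrelation h x)"
    using x z by (simp add: lin m_assoc[symmetric] algebra_simps)
  finally show ?thesis using cc by simp
qed

text \<open>
  In terms of Fourier coefficients, the energy is the sum over all characters
  \<open>\<theta>\<close> of \<open>\<bar>p^(\<theta>)\<bar>\<^sup>4 \<bar>g^(cnj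
  \<theta>)\<bar>\<^sup>4\<close>, while the mean square of \<open>g\<close> is the sum of
  \<open>\<bar>g^(\<theta>)\<bar>\<^sup>2\<close>. Among functions of mean square at most
  \<open>1\<close> it is therefore largest when \<open>g\<close> is concentrated on one character at
  which \<open>\<bar>p^\<bar>\<close> is maximal. This motivates the extremal problem; the proofs do
  not refer to Fourier coefficients.
\<close>

definition energy :: "('a \<Rightarrow> complex) \<Rightarrow> ('a \<Rightarrow> complex) \<Rightarrow> real" where
  "energy p g = mean_square (autocorrelation (correlation p g))"

text \<open>
  If \<open>g\<close> almost maximizes the energy, then its autocorrelation \<open>\<phi>\<close> is
  almost proportional to the symmetrized translate \<open>\<delta>\<close>: the left-hand side is
  the real Gram determinant of \<open>\<phi>\<close> and \<open>\<delta>\<close>. Indeed the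
  correlations of \<open>p\<close> with \<open>g \<plusminus> c * g (z \<otimes> _)\<close> have
  autocorrelations \<open>2 * (\<phi> \<plusminus> \<delta>)\<close>, and the mean squares of these
  two perturbations of \<open>g\<close> are at most \<open>2 * (1 \<plusminus> \<rho>)\<close> with
  one and the same \<open>\<rho>\<close>. The two bounds on the energy that result leave room for
  only a small distance between \<open>\<delta>\<close> and \<open>\<rho> * \<phi>\<close>, by
  strict convexity of the mean square.
\<close>

lemma energy_defect:
  fixes p g z c
  defines "\<phi> \<equiv> autocorrelation (correlation p g)"
  defines "\<delta> \<equiv> \<lambda>x. (c * autocorrelation (correlation p g) (inv z \<otimes> x)
      + cnj c * autocorrelation (correlation p g) (z \<otimes> x)) / 2"
  assumes p: "continuous_function p" and g: "continuous_function g"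
    and g1: "mean_square g \<le> 1" and s: "s \<ge> 0"
    and max: "\<And>g. continuous_function g \<Longrightarrow> energy p g \<le> s * (mean_square g)\<^sup>2"
    and z: "z \<in> carrier G" and c: "norm c = 1"
  shows "mean_square \<phi> * mean_square \<delta> - (Re (inner_mean \<phi> \<delta>))\<^sup>2 \<le> mean_square \<phi> * (s - mean_square \<phi>)"
proof -
  define h where "h = correlation p g"
  define \<rho> where "\<rho> = Re (c * autocorrelation g z)"
  have h: "continuous_function h" unfolding h_def by (rule continuous_correlation[OF p g])
  have \<phi>: "continuous_function \<phi>" unfolding \<phi>_def using h unfolding h_def by (rule continuous_autocorrelation)
  have \<delta>: "continuous_function \<delta>"
  proof -
    have "continuous_function (\<lambda>x. (1/2) * (c * \<phi> (inv z \<otimes> x) + cnj c * \<phi> (z \<otimes> x)))"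
      using \<phi> z by (intro continuous_map_add continuous_function_cmult continuous_function_translate) auto
    then show ?thesis unfolding \<delta>_def \<phi>_def by simp
  qed
  have key: "mean_square \<phi> + 2 * (\<sigma> * Re (inner_mean \<phi> \<delta>)) + mean_square \<delta> \<le> s * (1 + \<sigma> * \<rho>)\<^sup>2
      \<and> 0 \<le> 1 + \<sigma> * \<rho>" if \<sigma>: "\<sigma> = 1 \<or> \<sigma> = -1" for \<sigma> :: real
  proof -
    define c' where "c' = of_real \<sigma> * c"
    have c': "norm c' = 1" using \<sigma> c unfolding c'_def by (auto simp: norm_mult)
    define g' where "g' y = g y + c' * g (z \<otimes> y)" for y
    have g': "continuous_function g'"
      unfolding g'_def using g z by (intro continuous_map_add continuous_function_cmult continuous_function_translate)
    have ms: "mean_square g' = 2 * (mean_square g + \<sigma> * \<rho>)"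
      using mean_square_add_modulated_translate[OF g z c']
      unfolding g'_def \<rho>_def c'_def by (simp add: mult.assoc)
    have nn: "0 \<le> mean_square g + \<sigma> * \<rho>" using mean_square_nonneg[OF g'] ms by simp
    have h': "continuous_function (\<lambda>x. h x + c' * h (inv z \<otimes> x))"
      using h z by (intro continuous_map_add continuous_function_cmult continuous_function_translate) auto
    have corr: "correlation p g' x = h x + c' * h (inv z \<otimes> x)" if "x \<in> carrier G" for x
      unfolding g'_def h_def by (rule correlation_add_modulated_translate[OF p g z that])
    have auto': "autocorrelation (correlation p g') x = 2 * (\<phi> x + of_real \<sigma> * \<delta> x)" if x: "x \<in> carrier G" for x
    proof -
      have "autocorrelation (correlation p g') x = autocorrelation (\<lambda>x. h x + c' * h (inv z \<otimes> x)) x"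
        using corr continuous_correlation[OF p g'] by (intro autocorrelation_cong x)
      also have "\<dots> = 2 * \<phi> x + (c' * \<phi> (inv z \<otimes> x) + cnj c' * \<phi> (z \<otimes> x))"
        unfolding \<phi>_def h_def[symmetric] by (rule autocorrelation_add_modulated_translate[OF h z x c'])
      also have "\<dots> = 2 * (\<phi> x + of_real \<sigma> * \<delta> x)"
        unfolding \<delta>_def \<phi>_def c'_def by (simp add: algebra_simps)
      finally show ?thesis .
    qed
    have \<sigma>\<delta>: "continuous_function (\<lambda>x. of_real \<sigma> * \<delta> x)" by (rule continuous_function_cmult[OF \<delta>])
    have sum': "continuous_function (\<lambda>x. \<phi> x + of_real \<sigma> * \<delta> x)" by (rule continuous_map_add[OF \<phi> \<sigma>\<delta>])
    have "energy p g' = mean_square (\<lambda>x. 2 * (\<phi> x + of_real \<sigma> * \<delta> x))"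
      unfolding energy_def using auto'
      by (intro mean_square_cong continuous_autocorrelation continuous_correlation p g')
    also have "\<dots> = 4 * mean_square (\<lambda>x. \<phi> x + of_real \<sigma> * \<delta> x)"
      using mean_square_cmult[OF sum', of 2] by simp
    also have "mean_square (\<lambda>x. \<phi> x + of_real \<sigma> * \<delta> x)
        = mean_square \<phi> + 2 * (\<sigma> * Re (inner_mean \<phi> \<delta>)) + mean_square \<delta>"
      using mean_square_add[OF \<phi> \<sigma>\<delta>] mean_square_cmult[OF \<delta>, of "of_real \<sigma>"]
        inner_mean_cmult_right[OF \<phi> \<delta>, of "of_real \<sigma>"] \<sigma> by auto
    finally have "4 * (mean_square \<phi> + 2 * (\<sigma> * Re (inner_mean \<phi> \<delta>)) + mean_square \<delta>) \<le> s * (mean_square g')\<^sup>2"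
      using max[OF g'] by simp
    also have "\<dots> \<le> s * (2 * (1 + \<sigma> * \<rho>))\<^sup>2"
      unfolding ms using nn g1 s by (intro mult_left_mono power_mono) auto
    also have "\<dots> = 4 * (s * (1 + \<sigma> * \<rho>)\<^sup>2)" by (simp add: power2_eq_square algebra_simps)
    finally show ?thesis using nn g1 by simp
  qed
  define \<alpha> \<beta> \<gamma> where "\<alpha> = mean_square \<phi>" and "\<beta> = mean_square \<delta>" and "\<gamma> = Re (inner_mean \<phi> \<delta>)"
  have \<alpha>: "\<alpha> \<ge> 0" unfolding \<alpha>_def by (rule mean_square_nonneg[OF \<phi>])
  have plus: "\<alpha> + 2 * \<gamma> + \<beta> \<le> s * (1 + \<rho>)\<^sup>2" "0 \<le> 1 + \<rho>"
    and minus: "\<alpha> - 2 * \<gamma> + \<beta> \<le> s * (1 - \<rho>)\<^sup>2" "0 \<le> 1 - \<rho>"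
    using key[of 1] key[of "-1"] unfolding \<alpha>_def \<beta>_def \<gamma>_def by auto
  have le_s: "\<alpha> \<le> s"
  proof -
    have "\<alpha> \<le> s * (mean_square g)\<^sup>2" using max[OF g] unfolding \<alpha>_def \<phi>_def energy_def .
    also have "\<dots> \<le> s * 1" using g1 s mean_square_nonneg[OF g] by (intro mult_left_mono) (auto simp: power_le_one)
    finally show ?thesis by simp
  qed
  \<comment> \<open>Weighting the two bounds by \<open>1 - \<rho>\<close> and \<open>1 + \<rho>\<close> bounds the mean square of \<open>\<delta> - \<rho> \<phi>\<close>.\<close>
  have "(1 - \<rho>) * (\<alpha> + 2 * \<gamma> + \<beta>) + (1 + \<rho>) * (\<alpha> - 2 * \<gamma> + \<beta>)
      \<le> (1 - \<rho>) * (s * (1 + \<rho>)\<^sup>2) + (1 + \<rho>) * (s * (1 - \<rho>)\<^sup>2)"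
    using plus minus by (intro add_mono mult_left_mono)
  then have "\<beta> - 2 * \<rho> * \<gamma> + \<rho>\<^sup>2 * \<alpha> \<le> (1 - \<rho>\<^sup>2) * (s - \<alpha>)"
    by (simp add: power2_eq_square algebra_simps)
  also have "\<dots> \<le> 1 * (s - \<alpha>)" using le_s by (intro mult_right_mono) auto
  finally have "\<alpha> * (\<beta> - 2 * \<rho> * \<gamma> + \<rho>\<^sup>2 * \<alpha>) \<le> \<alpha> * (s - \<alpha>)" using \<alpha> by (intro mult_left_mono) auto
  moreover have "\<alpha> * \<beta> - \<gamma>\<^sup>2 = \<alpha> * (\<beta> - 2 * \<rho> * \<gamma> + \<rho>\<^sup>2 * \<alpha>) - (\<gamma> - \<rho> * \<alpha>)\<^sup>2"
    by (simp add: power2_eq_square algebra_simps)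
  ultimately show ?thesis unfolding \<alpha>_def \<beta>_def \<gamma>_def using zero_le_power2[of "\<gamma> - \<rho> * \<alpha>"]
    unfolding \<alpha>_def \<beta>_def \<gamma>_def by linarith
qed

lemma energy_scale:
  assumes p: "continuous_function p" and g: "continuous_function g"
  shows "energy p (\<lambda>x. of_real t * g x) = t ^ 4 * energy p g"
proof -
  define h where "h = correlation p g"
  have h: "continuous_function h" unfolding h_def by (rule continuous_correlation[OF p g])
  have tg: "continuous_function (\<lambda>x. of_real t * g x)" by (rule continuous_function_cmult[OF g])
  have th: "continuous_function (\<lambda>x. of_real t * h x)" by (rule continuous_function_cmult[OF h])
  have corr: "correlation p (\<lambda>x. of_real t * g x) x = of_real t * h x" if x: "x \<in> carrier G" for x
    using mean_cmult[of "\<lambda>y. p (x \<otimes> y) * g y" "of_real t"] p g x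
    by (simp add: correlation_def h_def mult.left_commute continuous_function_mult continuous_function_translate)
  have auto': "autocorrelation (correlation p (\<lambda>x. of_real t * g x)) x = of_real (t\<^sup>2) * autocorrelation h x"
    if x: "x \<in> carrier G" for x
  proof -
    have "autocorrelation (correlation p (\<lambda>x. of_real t * g x)) x = autocorrelation (\<lambda>x. of_real t * h x) x"
      by (intro autocorrelation_cong continuous_correlation p tg corr x)
    also have "\<dots> = M (\<lambda>y. of_real (t\<^sup>2) * (h (x \<otimes> y) * cnj (h y)))"
      unfolding autocorrelation_altdef inner_mean_def by (simp add: power2_eq_square mult_ac)
    also have "\<dots> = of_real (t\<^sup>2) * autocorrelation h x"
      unfolding autocorrelation_altdef inner_mean_def
      using h x by (intro mean_cmult continuous_function_intros)
    finally show ?thesis .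
  qed
  have "energy p (\<lambda>x. of_real t * g x) = mean_square (\<lambda>x. of_real (t\<^sup>2) * autocorrelation h x)"
    unfolding energy_def
    by (intro mean_square_cong continuous_autocorrelation continuous_correlation p tg auto')
  also have "\<dots> = t ^ 4 * energy p g"
    using mean_square_cmult[OF continuous_autocorrelation[OF h], of "of_real (t\<^sup>2)"]
    by (simp add: energy_def h_def norm_power power_mult[symmetric] del: of_real_power)
  finally show ?thesis .
qed

lemma energy_nonneg:
  "continuous_function p \<Longrightarrow> continuous_function g \<Longrightarrow> energy p g \<ge> 0"
  unfolding energy_def by (intro mean_square_nonneg continuous_autocorrelation continuous_correlation)

lemma maximizing_sequence:
  assumes p: "continuous_function p"
  obtains s g where "s \<ge> 0" "\<And>g. continuous_function g \<Longrightarrow> energy p g \<le> s * (mean_square g)\<^sup>2"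
    "\<And>n::nat. continuous_function (g n)" "\<And>n. mean_square (g n) \<le> 1"
    "(\<lambda>n. energy p (g n)) \<longlonglongrightarrow> s"
proof -
  define S where "S = energy p ` {g. continuous_function g \<and> mean_square g \<le> 1}"
  obtain B where B: "B \<ge> 0" "\<And>x. x \<in> carrier G \<Longrightarrow> norm (p x) \<le> B"
    using continuous_function_bounded[OF p] by blast
  have bound: "energy p g \<le> (B\<^sup>2)\<^sup>2" if g: "continuous_function g" "mean_square g \<le> 1" for g
  proof -
    define h where "h = correlation p g"
    have h: "continuous_function h" unfolding h_def by (rule continuous_correlation[OF p g(1)])
    have hB: "norm (h x) \<le> B" if "x \<in> carrier G" for x
    proof -
      have "norm (h x) \<le> B * (1 + mean_square g) / 2"
        unfolding h_def by (rule norm_correlation_le[OF p g(1) that B(2)])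
      also have "\<dots> \<le> B * (1 + 1) / 2"
        using g(2) B(1) by (intro divide_right_mono mult_left_mono add_left_mono) auto
      finally show ?thesis by simp
    qed
    have "norm (autocorrelation h x) \<le> B\<^sup>2" if x: "x \<in> carrier G" for x
      unfolding autocorrelation_altdef inner_mean_def
    proof (rule norm_mean_le_const)
      show "continuous_function (\<lambda>y. h (x \<otimes> y) * cnj (h y))"
        using h x by (intro continuous_function_intros)
      show "norm (h (x \<otimes> y) * cnj (h y)) \<le> B\<^sup>2" if "y \<in> carrier G" for y
        unfolding norm_mult complex_mod_cnj power2_eq_square
        using hB x that B(1) by (intro mult_mono) auto
    qed
    then show ?thesis
      unfolding energy_def h_def[symmetric] by (intro mean_square_le continuous_autocorrelation h)
  qed
  then have bdd: "bdd_above S" unfolding S_def bdd_above_def by auto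
  have mean_square_0: "mean_square (\<lambda>x. 0) = 0"
    by (simp add: mean_square_def inner_mean_def mean_const)
  have "energy p (\<lambda>x. 0) \<in> S" unfolding S_def using mean_square_0 by (intro imageI) simp
  then have ne: "S \<noteq> {}" by blast
  define s where "s = Sup S"
  have upper: "energy p g \<le> s" if "continuous_function g" "mean_square g \<le> 1" for g
    unfolding s_def using that by (intro cSup_upper[OF _ bdd]) (auto simp: S_def)
  have s0: "s \<ge> 0"
    using upper[of "\<lambda>x. 0"] mean_square_0 energy_nonneg[OF p, of "\<lambda>x. 0"] by simp
  have hom: "energy p g \<le> s * (mean_square g)\<^sup>2" if g: "continuous_function g" for g
  proof (cases "mean_square g = 0")
    case True
    then have "energy p g = energy p (\<lambda>x. of_real 0 * g x)"
      unfolding energy_def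
      using mean_square_eq_0D[OF g]
      by (intro mean_square_cong continuous_autocorrelation continuous_correlation p g
          autocorrelation_cong) (auto simp: correlation_def intro!: mean_cong continuous_function_mult
            continuous_function_translate p g)
    also have "\<dots> = 0" using energy_scale[OF p g, of 0] by simp
    finally show ?thesis using True by simp
  next
    case False
    then have pos: "mean_square g > 0" using mean_square_nonneg[OF g] by simp
    define t where "t = 1 / sqrt (mean_square g)"
    have t: "t\<^sup>2 * mean_square g = 1" unfolding t_def using pos by (simp add: power_divide)
    have "energy p (\<lambda>x. of_real t * g x) \<le> s"
      using mean_square_cmult[OF g, of "of_real t"] t g
      by (intro upper continuous_function_cmult) auto
    then have "t ^ 4 * energy p g \<le> s" using energy_scale[OF p g] by simp
    then have "(t ^ 4 * energy p g) * (mean_square g)\<^sup>2 \<le> s * (mean_square g)\<^sup>2"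
      by (intro mult_right_mono) auto
    moreover have "(t ^ 4 * energy p g) * (mean_square g)\<^sup>2 = (t\<^sup>2 * mean_square g)\<^sup>2 * energy p g"
      by (simp add: power_mult_distrib power_mult[symmetric])
    ultimately show ?thesis using t by simp
  qed
  have "\<exists>g. continuous_function g \<and> mean_square g \<le> 1 \<and> s - inverse (real (Suc n)) < energy p g" for n
  proof -
    have "s - inverse (real (Suc n)) < Sup S" unfolding s_def by simp
    then show ?thesis using less_cSup_iff[OF ne bdd] unfolding S_def by auto
  qed
  then obtain g where g: "\<And>n. continuous_function (g n)" "\<And>n. mean_square (g n) \<le> 1"
    "\<And>n. s - inverse (real (Suc n)) < energy p (g n)" by metis
  have "(\<lambda>n. energy p (g n)) \<longlonglongrightarrow> s"
  proof (rule real_tendsto_sandwich)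
    show "(\<lambda>n. s - inverse (real (Suc n))) \<longlonglongrightarrow> s"
      using tendsto_diff[OF tendsto_const LIMSEQ_inverse_real_of_nat, of s] by simp
    show "\<forall>\<^sub>F n in sequentially. s - inverse (real (Suc n)) \<le> energy p (g n)"
      using g(3) by (intro always_eventually allI less_imp_le)
    show "\<forall>\<^sub>F n in sequentially. energy p (g n) \<le> s"
      by (intro always_eventually allI upper g)
  qed simp
  with s0 hom g that show thesis by blast
qed

end

section \<open>Characters separate points\<close>

context invariant_mean
begin

text \<open>
  The correlations of \<open>p\<close> with a maximizing sequence are equicontinuous, so a
  subsequence converges uniformly. In the limit the defect of the preceding inequality vanishes:
  every symmetrized translate of the autocorrelation \<open>\<phi>\<close> of the limit is a
  multiple of \<open>\<phi>\<close>, and then so is every translate. The maximizing sequence itself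
  need not converge, only its correlations do.
\<close>

theorem extremal_autocorrelation:
  assumes p: "continuous_function p" and x0: "x0 \<in> carrier G" "p x0 \<noteq> 0"
  obtains g h where "\<And>n::nat. continuous_function (g n)" "continuous_function h"
    "uniform_limit (carrier G) (\<lambda>n. correlation p (g n)) h sequentially"
    "mean_square h > 0"
    "\<And>z. z \<in> carrier G \<Longrightarrow> \<exists>\<gamma>. \<forall>x\<in>carrier G. autocorrelation h (z \<otimes> x) = \<gamma> * autocorrelation h x"
proof -
  obtain s g where s: "s \<ge> 0" "\<And>g. continuous_function g \<Longrightarrow> energy p g \<le> s * (mean_square g)\<^sup>2"
    and g: "\<And>n::nat. continuous_function (g n)" "\<And>n. mean_square (g n) \<le> 1"
    and gs: "(\<lambda>n. energy p (g n)) \<longlonglongrightarrow> s"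
    using maximizing_sequence[OF p] by blast
  obtain B where B: "B \<ge> 0" "\<And>x. x \<in> carrier G \<Longrightarrow> norm (p x) \<le> B"
    using continuous_function_bounded[OF p] by blast
  have hB: "norm (correlation p (g n) x) \<le> B" if "x \<in> carrier G" for n x
  proof -
    have "norm (correlation p (g n) x) \<le> B * (1 + mean_square (g n)) / 2"
      by (rule norm_correlation_le[OF p g(1) that B(2)])
    also have "\<dots> \<le> B * (1 + 1) / 2"
      using g(2)[of n] B(1) by (intro divide_right_mono mult_left_mono add_left_mono) auto
    finally show ?thesis by simp
  qed
  obtain k :: "nat \<Rightarrow> nat" and h where k: "strict_mono k" and h: "continuous_function h"
    and lim: "uniform_limit (carrier G) (\<lambda>n. correlation p (g (k n))) h sequentially"
  proof (rule equicontinuous_subsequence[of "\<lambda>n. correlation p (g n)" B])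
    show "\<exists>U. openin T U \<and> \<one> \<in> U \<and> (\<forall>n. \<forall>v\<in>U. \<forall>x\<in>carrier G.
        norm (correlation p (g n) (v \<otimes> x) - correlation p (g n) x) \<le> \<epsilon>)" if \<epsilon>: "\<epsilon> > 0" for \<epsilon>
    proof -
      obtain U where "openin T U" "\<one> \<in> U" "\<And>g v x. \<lbrakk>continuous_function g; mean_square g \<le> 1; v \<in> U; x \<in> carrier G\<rbrakk> \<Longrightarrow>
          norm (correlation p g (v \<otimes> x) - correlation p g x) \<le> \<epsilon>"
        using correlation_equicontinuous[OF p \<epsilon>] by blast
      with g show ?thesis by (intro exI[of _ U]) simp
    qed
  qed (use hB in auto)
  define \<phi> where "\<phi> = autocorrelation h"
  define \<psi> where "\<psi> n = autocorrelation (correlation p (g (k n)))" for n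
  have \<phi>: "continuous_function \<phi>" unfolding \<phi>_def by (rule continuous_autocorrelation[OF h])
  have \<psi>: "continuous_function (\<psi> n)" for n
    unfolding \<psi>_def by (intro continuous_autocorrelation continuous_correlation p g)
  have \<psi>lim: "uniform_limit (carrier G) \<psi> \<phi> sequentially"
    unfolding \<phi>_def \<psi>_def using continuous_correlation[OF p g(1)] h hB lim
    by (intro autocorrelation_uniform_limit) auto
  have "(\<lambda>n. mean_square (\<psi> n)) \<longlonglongrightarrow> s"
    using LIMSEQ_subseq_LIMSEQ[OF gs k] by (simp add: o_def energy_def \<psi>_def)
  then have \<phi>s: "mean_square \<phi> = s"
    using mean_square_tendsto[OF \<psi> \<phi> \<psi>lim] LIMSEQ_unique by blast
  have pc: "continuous_function (\<lambda>y. cnj (p y))" by (rule continuous_function_cnj[OF p])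
  \<comment> \<open>Otherwise the energy vanishes at \<open>cnj p\<close>, but its correlation with \<open>p\<close> takes the mean square of \<open>p\<close> as value at \<open>\<one>\<close>.\<close>
  have s_pos: "s > 0"
  proof (rule ccontr)
    assume "\<not> s > 0"
    then have "energy p (\<lambda>y. cnj (p y)) = 0"
      using s energy_nonneg[OF p pc] s(2)[OF pc] by simp
    define q where "q = correlation p (\<lambda>y. cnj (p y))"
    have q: "continuous_function q" unfolding q_def by (rule continuous_correlation[OF p pc])
    have "autocorrelation q \<one> = 0"
      using mean_square_eq_0D[OF continuous_autocorrelation[OF q] _ one_closed]
        \<open>energy p (\<lambda>y. cnj (p y)) = 0\<close> by (simp add: energy_def q_def)
    then have "q \<one> = 0" using mean_square_eq_0D[OF q _ one_closed] by (simp add: autocorrelation_one q)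
    then have "autocorrelation p \<one> = 0" by (simp add: q_def autocorrelation_def)
    then have "p x0 = 0" using mean_square_eq_0D[OF p _ x0(1)] by (simp add: autocorrelation_one p)
    with x0(2) show False by simp
  qed
  have symm: "\<exists>\<rho>::real. \<forall>x\<in>carrier G. (c * \<phi> (inv z \<otimes> x) + cnj c * \<phi> (z \<otimes> x)) / 2 = of_real \<rho> * \<phi> x"
    if z: "z \<in> carrier G" and c: "norm c = 1" for z c
  proof -
    have iz: "inv z \<in> carrier G" using z by simp
    define D where "D f x = (c * f (inv z \<otimes> x) + cnj c * f (z \<otimes> x)) / 2" for f x
    have D_alt: "D f = (\<lambda>x. (c/2) * f (inv z \<otimes> x) + (cnj c/2) * f (z \<otimes> x))" for f
      unfolding D_def by (auto simp: add_divide_distrib)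
    have D: "continuous_function (D f)" if "continuous_function f" for f
      unfolding D_alt using that z iz
      by (intro continuous_map_add continuous_function_cmult continuous_function_translate)
    have Dlim: "uniform_limit (carrier G) (\<lambda>n. D (\<psi> n)) (D \<phi>) sequentially"
      unfolding D_alt using \<psi>lim z iz
      by (intro uniform_limit_add bounded_linear.uniform_limit[OF bounded_linear_mult_right] uniform_limit_translate)
    have "mean_square (\<psi> n) * mean_square (D (\<psi> n)) - (Re (inner_mean (\<psi> n) (D (\<psi> n))))\<^sup>2
        \<le> mean_square (\<psi> n) * (s - mean_square (\<psi> n))" for n
      unfolding D_def \<psi>_def by (rule energy_defect[OF p g(1) g(2) s z c])
    moreover have "(\<lambda>n. mean_square (\<psi> n) * mean_square (D (\<psi> n)) - (Re (inner_mean (\<psi> n) (D (\<psi> n))))\<^sup>2)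
        \<longlonglongrightarrow> mean_square \<phi> * mean_square (D \<phi>) - (Re (inner_mean \<phi> (D \<phi>)))\<^sup>2"
      by (intro tendsto_intros mean_square_tendsto inner_mean_tendsto \<psi> \<phi> \<psi>lim Dlim D[OF \<psi>] D[OF \<phi>])
    moreover have "(\<lambda>n. mean_square (\<psi> n) * (s - mean_square (\<psi> n))) \<longlonglongrightarrow> mean_square \<phi> * (s - mean_square \<phi>)"
      by (intro tendsto_intros mean_square_tendsto \<psi> \<phi> \<psi>lim)
    ultimately have det: "mean_square \<phi> * mean_square (D \<phi>) - (Re (inner_mean \<phi> (D \<phi>)))\<^sup>2
        \<le> mean_square \<phi> * (s - mean_square \<phi>)"
      by (intro LIMSEQ_le) auto
    define \<rho> where "\<rho> = Re (inner_mean \<phi> (D \<phi>)) / s"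
    have \<rho>\<phi>: "continuous_function (\<lambda>x. of_real (-\<rho>) * \<phi> x)" by (rule continuous_function_cmult[OF \<phi>])
    have sum': "continuous_function (\<lambda>x. D \<phi> x + of_real (-\<rho>) * \<phi> x)"
      by (rule continuous_map_add[OF D[OF \<phi>] \<rho>\<phi>])
    have "Re (inner_mean (D \<phi>) (\<lambda>x. of_real (-\<rho>) * \<phi> x)) = - (\<rho> * Re (inner_mean \<phi> (D \<phi>)))"
      using inner_mean_cmult_right[OF D[OF \<phi>] \<phi>, of "of_real (-\<rho>)"] inner_mean_cnj[OF \<phi> D[OF \<phi>]] by simp
    then have "mean_square (\<lambda>x. D \<phi> x + of_real (-\<rho>) * \<phi> x)
        = mean_square (D \<phi>) - 2 * (\<rho> * Re (inner_mean \<phi> (D \<phi>))) + \<rho>\<^sup>2 * s"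
      using mean_square_add[OF D[OF \<phi>] \<rho>\<phi>] mean_square_cmult[OF \<phi>, of "of_real (-\<rho>)"] \<phi>s by simp
    also have "s * \<dots> = s * mean_square (D \<phi>) - (Re (inner_mean \<phi> (D \<phi>)))\<^sup>2"
      using s_pos unfolding \<rho>_def by (simp add: field_simps power2_eq_square)
    also have "\<dots> \<le> 0" using det \<phi>s by simp
    finally have "mean_square (\<lambda>x. D \<phi> x + of_real (-\<rho>) * \<phi> x) \<le> 0"
      using s_pos by (simp add: mult_le_0_iff)
    then have "mean_square (\<lambda>x. D \<phi> x + of_real (-\<rho>) * \<phi> x) = 0"
      using mean_square_nonneg[OF sum'] by simp
    then have "D \<phi> x + of_real (-\<rho>) * \<phi> x = 0" if "x \<in> carrier G" for x
      using mean_square_eq_0D[OF sum' _ that] by simp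
    then show ?thesis unfolding D_def by (intro exI[of _ \<rho>]) (simp add: eq_neg_iff_add_eq_0)
  qed
  have "\<exists>\<gamma>. \<forall>x\<in>carrier G. \<phi> (z \<otimes> x) = \<gamma> * \<phi> x" if z: "z \<in> carrier G" for z
  proof -
    \<comment> \<open>The choices \<open>c = 1\<close> and \<open>c = \<i>\<close> isolate the translate by \<open>z\<close>.\<close>
    obtain \<rho>1 :: real where 1: "\<And>x. x \<in> carrier G \<Longrightarrow> (\<phi> (inv z \<otimes> x) + \<phi> (z \<otimes> x)) / 2 = of_real \<rho>1 * \<phi> x"
      using symm[OF z, of 1] by auto
    obtain \<rho>2 :: real where 2: "\<And>x. x \<in> carrier G \<Longrightarrow> (\<i> * \<phi> (inv z \<otimes> x) + cnj \<i> * \<phi> (z \<otimes> x)) / 2 = of_real \<rho>2 * \<phi> x"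
      using symm[OF z, of \<i>] by auto
    have "\<phi> (z \<otimes> x) = (of_real \<rho>1 + \<i> * of_real \<rho>2) * \<phi> x" if x: "x \<in> carrier G" for x
    proof -
      have "\<phi> (z \<otimes> x) = (\<phi> (inv z \<otimes> x) + \<phi> (z \<otimes> x)) / 2 + \<i> * ((\<i> * \<phi> (inv z \<otimes> x) + cnj \<i> * \<phi> (z \<otimes> x)) / 2)"
        by (simp add: field_simps)
      then show ?thesis unfolding 1[OF x] 2[OF x] by (simp add: algebra_simps)
    qed
    then show ?thesis by blast
  qed
  moreover have "mean_square h > 0"
  proof (rule ccontr)
    assume "\<not> mean_square h > 0"
    then have "mean_square h = 0" using mean_square_nonneg[OF h] by simp
    then have "h x = 0" if "x \<in> carrier G" for x using mean_square_eq_0D[OF h _ that] by simp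
    then have "\<phi> x = 0" if "x \<in> carrier G" for x
      using that autocorrelation_cong[OF h _ that, of "\<lambda>_. 0"]
      by (simp add: \<phi>_def autocorrelation_altdef inner_mean_def mean_const)
    then have "mean_square \<phi> = mean_square (\<lambda>_. 0)" by (intro mean_square_cong \<phi>)
    then show False using s_pos \<phi>s by (simp add: mean_square_def inner_mean_def mean_const)
  qed
  ultimately show thesis
    using that[of "\<lambda>n. g (k n)" h] g(1) h lim unfolding \<phi>_def by blast
qed

end

lemma character_times:
  assumes "\<theta> \<in> characters G T" "x \<in> carrier G" "y \<in> carrier G"
  shows "\<theta> (x \<otimes>\<^bsub>G\<^esub> y) = \<theta> x * \<theta> y"
  using assms unfolding characters_def hom_def circle_group_def by auto

lemma norm_character:
  assumes "\<theta> \<in> characters G T" "x \<in> carrier G"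
  shows "norm (\<theta> x) = 1"
  using assms unfolding characters_def hom_def circle_group_def by auto

lemma character_continuous:
  assumes "\<theta> \<in> characters G T"
  shows "continuous_map T euclidean \<theta>"
  using assms continuous_map_into_fulltopology unfolding characters_def by blast

text \<open>
  The Peter--Weyl theorem in the abelian case. A function all of whose translates are multiples of
  it is a multiple of a character \<open>\<theta>\<close>; this applies to the autocorrelation of
  the extremal limit \<open>h\<close> for \<open>p y = f y - f (a \<otimes> y)\<close>, where
  \<open>f\<close> distinguishes \<open>a\<close> from \<open>\<one>\<close>. If \<open>\<theta> a =
  1\<close>, then \<open>h\<close> is invariant under \<open>a\<close>; but all correlations of
  \<open>p\<close>, hence their limit \<open>h\<close>, are orthogonal to the functions invariant
  under \<open>a\<close>, which forces \<open>h = 0\<close>.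
\<close>

theorem (in compact_metrizable_abelian_group) character_separating_from_one:
  assumes a: "a \<in> carrier G" "a \<noteq> \<one>"
  obtains \<theta> where "\<theta> \<in> characters G T" "\<theta> a \<noteq> 1"
proof -
  obtain M where "invariant_mean G T M" using invariant_mean_exists by blast
  then interpret invariant_mean G T M .
  have "closedin T {a}"
    by (rule closedin_Hausdorff_singleton[OF metrizable_imp_Hausdorff_space[OF metrizable]])
      (simp add: topspace_eq_carrier a)
  moreover have "\<one> \<in> topspace T - {a}" using a by (simp add: topspace_eq_carrier)
  ultimately obtain f0 where f0: "continuous_map T euclideanreal f0" "f0 \<one> = 0" "f0 ` {a} \<subseteq> {1}"
    using metrizable_imp_completely_regular_space[OF metrizable]
    unfolding completely_regular_space_alt by meson
  define f where "f x = complex_of_real (f0 x)" for x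
  have f: "continuous_function f"
  proof -
    have "continuous_map euclideanreal euclidean complex_of_real"
      by (simp add: continuous_on_of_real)
    from continuous_map_compose[OF f0(1) this] show ?thesis by (simp add: o_def f_def[abs_def])
  qed
  define p where "p y = f y - f (a \<otimes> y)" for y
  have fa: "continuous_function (\<lambda>y. f (a \<otimes> y))" by (rule continuous_function_translate[OF f a(1)])
  have p: "continuous_function p" unfolding p_def by (rule continuous_map_diff[OF f fa])
  have "p \<one> \<noteq> 0" using f0 a by (simp add: p_def f_def)
  then obtain g h where g: "\<And>n::nat. continuous_function (g n)" and h: "continuous_function h"
    and lim: "uniform_limit (carrier G) (\<lambda>n. correlation p (g n)) h sequentially"
    and h_pos: "mean_square h > 0"
    and eigen: "\<And>z. z \<in> carrier G \<Longrightarrow> \<exists>\<gamma>. \<forall>x\<in>carrier G. autocorrelation h (z \<otimes> x) = \<gamma> * autocorrelation h x"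
    using extremal_autocorrelation[OF p one_closed] by blast
  define \<phi> where "\<phi> = autocorrelation h"
  have \<phi>: "continuous_function \<phi>" unfolding \<phi>_def by (rule continuous_autocorrelation[OF h])
  have \<phi>1: "\<phi> \<one> = of_real (mean_square h)" unfolding \<phi>_def by (rule autocorrelation_one[OF h])
  then have \<phi>1_nz: "\<phi> \<one> \<noteq> 0" using h_pos by simp
  define \<theta> where "\<theta> x = \<phi> x / \<phi> \<one>" for x
  have mult: "\<theta> (z \<otimes> x) = \<theta> z * \<theta> x" if z: "z \<in> carrier G" and x: "x \<in> carrier G" for z x
  proof -
    obtain \<gamma> where \<gamma>: "\<And>x. x \<in> carrier G \<Longrightarrow> \<phi> (z \<otimes> x) = \<gamma> * \<phi> x"
      using eigen[OF z] unfolding \<phi>_def by blast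
    have "\<gamma> = \<theta> z" using \<gamma>[of \<one>] z \<phi>1_nz unfolding \<theta>_def by simp
    then show ?thesis using \<gamma>[OF x] unfolding \<theta>_def by simp
  qed
  have "norm (\<theta> x) = 1" if x: "x \<in> carrier G" for x
  proof -
    have "\<theta> (inv x) = cnj (\<theta> x)"
      unfolding \<theta>_def \<phi>1 using autocorrelation_inv[OF h x] by (simp add: \<phi>_def)
    then have "\<theta> x * cnj (\<theta> x) = \<theta> \<one>" using mult[OF x, of "inv x"] x by simp
    then have "(norm (\<theta> x))\<^sup>2 = 1"
      using \<phi>1_nz unfolding complex_norm_square[symmetric] \<theta>_def by (metis divide_self of_real_eq_1_iff)
    then show ?thesis using power2_eq_imp_eq[of "norm (\<theta> x)" 1] by simp
  qed
  moreover have "continuous_function \<theta>"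
    using continuous_function_cmult[OF \<phi>, of "1 / \<phi> \<one>"] by (simp add: \<theta>_def[abs_def])
  ultimately have char: "\<theta> \<in> characters G T"
    unfolding characters_def hom_def circle_group_def using mult
    by (auto simp: continuous_map_in_subtopology topspace_eq_carrier)
  have "\<theta> a \<noteq> 1"
  proof
    assume "\<theta> a = 1"
    then have "\<phi> a = \<phi> \<one>" using \<phi>1_nz by (simp add: \<theta>_def)
    have ha: "continuous_function (\<lambda>y. h (a \<otimes> y))" by (rule continuous_function_translate[OF h a(1)])
    have mh: "continuous_function (\<lambda>y. (-1) * h y)" by (rule continuous_function_cmult[OF h])
    have diff: "continuous_function (\<lambda>y. h (a \<otimes> y) + (-1) * h y)" by (rule continuous_map_add[OF ha mh])
    have "mean_square (\<lambda>y. h (a \<otimes> y) + (-1) * h y)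
        = mean_square h + 2 * Re (- \<phi> a) + mean_square h"
      using mean_square_add[OF ha mh] mean_square_translate[OF h a(1)] mean_square_cmult[OF h, of "-1"]
        inner_mean_cmult_right[OF ha h, of "-1"] by (simp add: \<phi>_def autocorrelation_altdef)
    also have "\<dots> = 0" using \<open>\<phi> a = \<phi> \<one>\<close> \<phi>1 by simp
    finally have inv_h: "h (a \<otimes> y) = h y" if "y \<in> carrier G" for y
      using mean_square_eq_0D[OF diff _ that] by simp
    have "inner_mean (correlation p (g n)) h = 0" for n
    proof -
      define e where "e = correlation f (g n)"
      have e: "continuous_function e" unfolding e_def by (rule continuous_correlation[OF f g])
      have ea: "continuous_function (\<lambda>x. e (a \<otimes> x))" by (rule continuous_function_translate[OF e a(1)])
      have hc: "continuous_function (\<lambda>x. cnj (h x))" by (rule continuous_function_cnj[OF h])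
      have corr: "correlation p (g n) x = e x - e (a \<otimes> x)" if x: "x \<in> carrier G" for x
      proof -
        have c1: "continuous_function (\<lambda>y. f (x \<otimes> y) * g n y)"
          using f g x by (intro continuous_function_mult continuous_function_translate)
        have c2: "continuous_function (\<lambda>y. f (a \<otimes> x \<otimes> y) * g n y)"
          using f g x a by (intro continuous_function_mult continuous_function_translate) auto
        have c3: "continuous_function (\<lambda>y. p (x \<otimes> y) * g n y)"
          using p g x by (intro continuous_function_mult continuous_function_translate)
        have "correlation p (g n) x = M (\<lambda>y. f (x \<otimes> y) * g n y - f (a \<otimes> x \<otimes> y) * g n y)"
          unfolding correlation_def
          by (rule mean_cong[OF c3]) (use x a in \<open>simp add: p_def m_assoc algebra_simps\<close>)
        also have "\<dots> = e x - e (a \<otimes> x)"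
          unfolding e_def correlation_def by (rule mean_diff[OF c1 c2])
        finally show ?thesis .
      qed
      have "inner_mean (correlation p (g n)) h = M (\<lambda>x. e x * cnj (h x) - e (a \<otimes> x) * cnj (h (a \<otimes> x)))"
        unfolding inner_mean_def
        by (rule mean_cong[OF continuous_function_mult[OF continuous_correlation[OF p g] hc]])
          (simp add: corr inv_h left_diff_distrib)
      also have "\<dots> = M (\<lambda>x. e x * cnj (h x)) - M (\<lambda>x. e (a \<otimes> x) * cnj (h (a \<otimes> x)))"
        using continuous_function_mult[OF e hc]
          continuous_function_translate[OF continuous_function_mult[OF e hc] a(1)]
        by (rule mean_diff)
      also have "\<dots> = 0" using mean_translate[OF continuous_function_mult[OF e hc] a(1)] by simp
      finally show ?thesis .
    qed
    moreover have "(\<lambda>n. inner_mean (correlation p (g n)) h) \<longlonglongrightarrow> inner_mean h h"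
      by (intro inner_mean_tendsto continuous_correlation p g h lim uniform_limit_const)
    ultimately have "inner_mean h h = 0" by (simp add: LIMSEQ_const_iff)
    then show False using h_pos by (simp add: mean_square_def)
  qed
  with char that show thesis by blast
qed

section \<open>Weighted families of characters\<close>

lemma (in abelian_topological_group) trivial_character: "(\<lambda>x. 1) \<in> characters G T"
  unfolding characters_def hom_def circle_group_def by auto

text \<open>
  The sets on which a given character differs from \<open>1\<close> form an open cover of the
  complement of \<open>\<one>\<close>, which is a Lindelof space. The trivial character is added so
  that the family is nonempty and can be enumerated.
\<close>

lemma (in compact_metrizable_abelian_group) separating_sequence_of_characters:
  obtains \<theta> :: "nat \<Rightarrow> 'a \<Rightarrow> complex" where "\<And>n. \<theta> n \<in> characters G T"
    "\<And>a. \<lbrakk>a \<in> carrier G; a \<noteq> \<one>\<rbrakk> \<Longrightarrow> \<exists>n. \<theta> n a \<noteq> 1"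
proof -
  define S where "S = carrier G - {\<one>}"
  define off where "off \<psi> = {x \<in> topspace T. \<psi> x \<in> - {1}}" for \<psi> :: "'a \<Rightarrow> complex"
  have "Lindelof_space (subtopology T S)"
    by (intro second_countable_imp_Lindelof_space second_countable_subtopology second_countable)
  moreover have "S \<subseteq> topspace T" unfolding S_def by (auto simp: topspace_eq_carrier)
  ultimately have lind: "\<forall>\<U>. (\<forall>U\<in>\<U>. openin T U) \<and> S \<subseteq> \<Union>\<U>
      \<longrightarrow> (\<exists>V. countable V \<and> V \<subseteq> \<U> \<and> S \<subseteq> \<Union>V)"
    by (simp only: Lindelof_space_subtopology_subset)
  have off_open: "openin T (off \<psi>)" if "\<psi> \<in> characters G T" for \<psi>
    unfolding off_def by (rule openin_continuous_map_preimage[OF character_continuous[OF that]]) auto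
  have off_cover: "\<exists>\<psi>\<in>characters G T. x \<in> off \<psi>" if x: "x \<in> S" for x
  proof -
    have xG: "x \<in> carrier G" "x \<noteq> \<one>" using x by (auto simp: S_def)
    obtain \<psi> where "\<psi> \<in> characters G T" "\<psi> x \<noteq> 1" by (rule character_separating_from_one[OF xG])
    with xG show ?thesis by (auto simp: off_def topspace_eq_carrier)
  qed
  have "(\<forall>U\<in>off ` characters G T. openin T U) \<and> S \<subseteq> \<Union>(off ` characters G T)"
    using off_open off_cover by auto
  from lind[rule_format, OF this]
  obtain \<V> where \<V>: "countable \<V>" "\<V> \<subseteq> off ` characters G T" "S \<subseteq> \<Union>\<V>" by blast
  then obtain K where K: "countable K" "K \<subseteq> characters G T" "\<V> = off ` K"
    using countable_subset_image[of \<V> off "characters G T"] by blast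
  define K' where "K' = insert (\<lambda>x. 1) K"
  have K': "countable K'" "K' \<noteq> {}" "K' \<subseteq> characters G T"
    using K trivial_character by (auto simp: K'_def)
  show thesis
  proof (rule that[of "from_nat_into K'"])
    show "from_nat_into K' n \<in> characters G T" for n
      using from_nat_into[OF K'(2)] K'(3) by blast
    fix a assume "a \<in> carrier G" "a \<noteq> \<one>"
    then have "a \<in> \<Union>\<V>" using \<V>(3) by (auto simp: S_def)
    then obtain \<psi> where "\<psi> \<in> K'" "\<psi> a \<noteq> 1" unfolding K(3) K'_def off_def by auto
    then show "\<exists>n. from_nat_into K' n a \<noteq> 1" using from_nat_into_surj[OF K'(1)] by metis
  qed
qed

text \<open>
  Squaring multiplies the distance to \<open>1\<close> by \<open>\<bar>z + 1\<bar>\<close>, which is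
  at least \<open>sqrt 2\<close> on the right half circle, and distances on the circle never exceed
  \<open>2\<close>.
\<close>

lemma norm_diff_one_le_of_powers_in_right_half:
  assumes "norm z = 1" "\<And>i. i \<le> m \<Longrightarrow> 0 \<le> Re (z ^ (2 ^ i))"
  shows "norm (z - 1) \<le> 2 / sqrt 2 ^ m"
  using assms
proof (induction m arbitrary: z)
  case 0
  then show ?case using norm_triangle_ineq4[of z 1] by simp
next
  case (Suc m)
  have "norm (z\<^sup>2) = 1" using Suc.prems(1) by (simp add: norm_power)
  moreover have "0 \<le> Re ((z\<^sup>2) ^ (2 ^ i))" if "i \<le> m" for i
    using Suc.prems(2)[of "Suc i"] that by (simp add: power_mult[symmetric])
  ultimately have IH: "norm (z\<^sup>2 - 1) \<le> 2 / sqrt 2 ^ m" by (rule Suc.IH)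
  have "sqrt 2 \<le> norm (z + 1)"
  proof (rule real_le_lsqrt)
    have "(Re z)\<^sup>2 + (Im z)\<^sup>2 = 1" using Suc.prems(1) by (simp add: cmod_def)
    moreover have "(norm (z + 1))\<^sup>2 = (Re z + 1)\<^sup>2 + (Im z)\<^sup>2" by (simp add: cmod_power2)
    ultimately show "2 \<le> (norm (z + 1))\<^sup>2"
      using Suc.prems(2)[of 0] by (simp add: power2_sum)
  qed simp_all
  then have "norm (z - 1) * sqrt 2 \<le> norm (z - 1) * norm (z + 1)" by (intro mult_left_mono) auto
  also have "\<dots> = norm (z\<^sup>2 - 1)" by (simp add: norm_mult[symmetric] power2_eq_square algebra_simps)
  finally have "norm (z - 1) * sqrt 2 \<le> 2 / sqrt 2 ^ m" using IH by linarith
  from mult_imp_le_div_pos[OF _ this] have "norm (z - 1) \<le> (2 / sqrt 2 ^ m) / sqrt 2" by simp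
  then show ?case by (simp add: mult.commute)
qed

text \<open>
  A weight of \<open>1\<close> makes a character take part in uniform convergence; characters whose
  weights tend to \<open>0\<close> only contribute pointwise convergence. Putting both kinds into
  one family treats the given sequence and a separating sequence alike.
\<close>

locale weighted_characters = compact_metrizable_abelian_group +
  fixes v :: "nat \<Rightarrow> 'a \<Rightarrow> complex" and w :: "nat \<Rightarrow> real"
  assumes characters: "v n \<in> characters G T"
    and separating: "\<lbrakk>a \<in> carrier G; a \<noteq> \<one>\<rbrakk> \<Longrightarrow> \<exists>n. v n a \<noteq> 1"
    and weight_pos: "0 < w n" and weight_le_one: "w n \<le> 1"
begin

definition null_subgroup :: "'a set" where
  "null_subgroup = {x \<in> carrier G. (\<lambda>n. w n * norm (v n x - 1)) \<longlonglongrightarrow> 0}"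

text \<open>
  The default value \<open>0\<close> makes the function symmetric and nonnegative also outside the
  group, as the metric space axioms demand.
\<close>

definition weighted_dist :: "'a \<Rightarrow> 'a \<Rightarrow> real" where
  "weighted_dist x y = (if x \<in> carrier G \<and> y \<in> carrier G then SUP n. w n * norm (v n x - v n y) else 0)"

lemma null_subgroup_carrier: "x \<in> null_subgroup \<Longrightarrow> x \<in> carrier G"
  unfolding null_subgroup_def by simp

lemma v_mult: "\<lbrakk>x \<in> carrier G; y \<in> carrier G\<rbrakk> \<Longrightarrow> v n (x \<otimes> y) = v n x * v n y"
  by (rule character_times[OF characters])

lemma norm_v: "x \<in> carrier G \<Longrightarrow> norm (v n x) = 1"
  by (rule norm_character[OF characters])

lemma v_one: "v n \<one> = 1"
  using v_mult[of \<one> \<one> n] norm_v[of \<one> n] by auto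

lemma v_inv: "x \<in> carrier G \<Longrightarrow> v n (inv x) = inverse (v n x)"
  using v_mult[of x "inv x" n] by (simp add: v_one inverse_unique)

lemma norm_v_inv_diff:
  assumes "x \<in> carrier G" "y \<in> carrier G"
  shows "norm (v n (inv x) - v n (inv y)) = norm (v n x - v n y)"
proof -
  have "v n x \<noteq> 0" "v n y \<noteq> 0" using norm_v[OF assms(1), of n] norm_v[OF assms(2), of n] by auto
  then have "inverse (v n x) - inverse (v n y) = - (inverse (v n x) * (v n x - v n y) * inverse (v n y))"
    by (rule inverse_diff_inverse)
  then show ?thesis
    by (simp add: v_inv assms norm_mult norm_inverse norm_v)
qed

lemma norm_v_mult_diff:
  assumes "x \<in> carrier G" "y \<in> carrier G" "x' \<in> carrier G" "y' \<in> carrier G"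
  shows "norm (v n (x \<otimes> y) - v n (x' \<otimes> y')) \<le> norm (v n x - v n x') + norm (v n y - v n y')"
proof -
  have "v n (x \<otimes> y) - v n (x' \<otimes> y') = (v n x - v n x') * v n y + v n x' * (v n y - v n y')"
    using assms by (simp add: v_mult algebra_simps)
  also have "norm \<dots> \<le> norm ((v n x - v n x') * v n y) + norm (v n x' * (v n y - v n y'))"
    by (rule norm_triangle_ineq)
  finally show ?thesis using assms by (simp add: norm_mult norm_v)
qed

lemma weighted_diff_le_2:
  assumes "x \<in> carrier G" "y \<in> carrier G"
  shows "w n * norm (v n x - v n y) \<le> 2"
proof -
  have "norm (v n x - v n y) \<le> 2"
    using norm_triangle_ineq4[of "v n x" "v n y"] assms by (simp add: norm_v)
  then have "w n * norm (v n x - v n y) \<le> 1 * 2"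
    using weight_le_one[of n] weight_pos[of n] by (intro mult_mono) auto
  then show ?thesis by simp
qed

lemma weighted_dist_le_iff:
  assumes "x \<in> carrier G" "y \<in> carrier G"
  shows "weighted_dist x y \<le> e \<longleftrightarrow> (\<forall>n. w n * norm (v n x - v n y) \<le> e)"
proof -
  have "bdd_above (range (\<lambda>n. w n * norm (v n x - v n y)))"
    using weighted_diff_le_2[OF assms] by (intro bdd_aboveI2)
  then show ?thesis unfolding weighted_dist_def using assms by (simp add: cSUP_le_iff)
qed

lemma weighted_diff_le_weighted_dist:
  "\<lbrakk>x \<in> carrier G; y \<in> carrier G\<rbrakk> \<Longrightarrow> w n * norm (v n x - v n y) \<le> weighted_dist x y"
  using weighted_dist_le_iff[of x y "weighted_dist x y"] by simp

lemma weighted_dist_nonneg: "0 \<le> weighted_dist x y"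
proof (cases "x \<in> carrier G \<and> y \<in> carrier G")
  case True
  have "0 \<le> w 0 * norm (v 0 x - v 0 y)" using weight_pos[of 0] by simp
  also have "\<dots> \<le> weighted_dist x y" using True weighted_diff_le_weighted_dist by simp
  finally show ?thesis .
next
  case False
  then show ?thesis unfolding weighted_dist_def by (subst if_not_P) auto
qed

lemma weighted_dist_mult_le:
  assumes "x \<in> carrier G" "y \<in> carrier G" "x' \<in> carrier G" "y' \<in> carrier G"
  shows "weighted_dist (x \<otimes> y) (x' \<otimes> y') \<le> weighted_dist x x' + weighted_dist y y'"
proof -
  have "w n * norm (v n (x \<otimes> y) - v n (x' \<otimes> y')) \<le> weighted_dist x x' + weighted_dist y y'" for n
  proof -
    have "w n * norm (v n (x \<otimes> y) - v n (x' \<otimes> y')) \<le> w n * (norm (v n x - v n x') + norm (v n y - v n y'))"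
      using norm_v_mult_diff[OF assms, of n] weight_pos[of n] by (intro mult_left_mono) auto
    also have "\<dots> \<le> weighted_dist x x' + weighted_dist y y'"
      using weighted_diff_le_weighted_dist[of x x' n] weighted_diff_le_weighted_dist[of y y' n] assms by (simp add: distrib_left)
    finally show ?thesis .
  qed
  then show ?thesis using assms by (subst weighted_dist_le_iff) auto
qed

lemma weighted_dist_inv: "\<lbrakk>x \<in> carrier G; y \<in> carrier G\<rbrakk> \<Longrightarrow> weighted_dist (inv x) (inv y) = weighted_dist x y"
  unfolding weighted_dist_def by (simp add: norm_v_inv_diff)

sublocale metric: Metric_space null_subgroup weighted_dist
proof
  show "0 \<le> weighted_dist x y" for x y by (rule weighted_dist_nonneg)
  show "weighted_dist x y = weighted_dist y x" for x y unfolding weighted_dist_def by (simp add: norm_minus_commute)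
  show "weighted_dist x y = 0 \<longleftrightarrow> x = y" if xy: "x \<in> null_subgroup" "y \<in> null_subgroup" for x y
  proof
    have x: "x \<in> carrier G" and y: "y \<in> carrier G" using xy null_subgroup_carrier by auto
    assume 0: "weighted_dist x y = 0"
    have eq: "v n x = v n y" for n
      using weighted_diff_le_weighted_dist[OF x y, of n] 0 weight_pos[of n] by (simp add: mult_le_0_iff)
    have "v n (x \<otimes> inv y) = 1" for n
    proof -
      have "v n y \<noteq> 0" using norm_v[OF y, of n] by auto
      then show ?thesis using x y by (simp add: v_mult v_inv eq)
    qed
    then have "x \<otimes> inv y = \<one>" using separating[of "x \<otimes> inv y"] x y by auto
    then show "x = y" using x y inv_equality inv_inv by (metis inv_closed)
  qed (use xy in \<open>simp add: weighted_dist_def\<close>)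
  show "weighted_dist x z \<le> weighted_dist x y + weighted_dist y z" if xyz: "x \<in> null_subgroup" "y \<in> null_subgroup" "z \<in> null_subgroup" for x y z
  proof -
    have G: "x \<in> carrier G" "y \<in> carrier G" "z \<in> carrier G" using xyz null_subgroup_carrier by auto
    have "w n * norm (v n x - v n z) \<le> weighted_dist x y + weighted_dist y z" for n
    proof -
      have "w n * norm (v n x - v n z) \<le> w n * (norm (v n x - v n y) + norm (v n y - v n z))"
        using weight_pos[of n] norm_triangle_ineq[of "v n x - v n y" "v n y - v n z"]
        by (intro mult_left_mono) auto
      then show ?thesis
        using weighted_diff_le_weighted_dist[of x y n] weighted_diff_le_weighted_dist[of y z n] G by (simp add: distrib_left)
    qed
    then show ?thesis using G by (simp add: weighted_dist_le_iff)
  qed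
qed

lemma subgroup_null_subgroup: "subgroup null_subgroup G"
proof
  show "null_subgroup \<subseteq> carrier G" using null_subgroup_carrier by blast
  show "\<one> \<in> null_subgroup" unfolding null_subgroup_def by (simp add: v_one)
  show "inv x \<in> null_subgroup" if "x \<in> null_subgroup" for x
    using that norm_v_inv_diff[of x \<one>] unfolding null_subgroup_def by (simp add: v_one)
  show "x \<otimes> y \<in> null_subgroup" if x: "x \<in> null_subgroup" and y: "y \<in> null_subgroup" for x y
  proof -
    have G: "x \<in> carrier G" "y \<in> carrier G" using x y null_subgroup_carrier by auto
    have "(\<lambda>n. w n * norm (v n (x \<otimes> y) - 1)) \<longlonglongrightarrow> 0"
    proof (rule tendsto_sandwich[where f = "\<lambda>_. 0"])
      show "(\<lambda>n. w n * norm (v n x - 1) + w n * norm (v n y - 1)) \<longlonglongrightarrow> 0"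
        using x y tendsto_add_zero unfolding null_subgroup_def by blast
      show "\<forall>\<^sub>F n in sequentially. w n * norm (v n (x \<otimes> y) - 1)
          \<le> w n * norm (v n x - 1) + w n * norm (v n y - 1)"
      proof (intro always_eventually allI)
        fix n
        have "w n * norm (v n (x \<otimes> y) - 1) \<le> w n * (norm (v n x - 1) + norm (v n y - 1))"
          using norm_v_mult_diff[of x y \<one> \<one> n] G weight_pos[of n]
          by (intro mult_left_mono) (auto simp: v_one)
        then show "w n * norm (v n (x \<otimes> y) - 1) \<le> w n * norm (v n x - 1) + w n * norm (v n y - 1)"
          by (simp add: distrib_left)
      qed
      show "\<forall>\<^sub>F n in sequentially. 0 \<le> w n * norm (v n (x \<otimes> y) - 1)"
        using weight_pos by (intro always_eventually allI mult_nonneg_nonneg) (auto intro: less_imp_le)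
    qed auto
    with G show ?thesis unfolding null_subgroup_def by simp
  qed
qed

lemma abelian_topological_group_null_subgroup: "abelian_topological_group (G\<lparr>carrier := null_subgroup\<rparr>) metric.mtopology"
proof -
  interpret sub: group "G\<lparr>carrier := null_subgroup\<rparr>" by (rule subgroup_imp_group[OF subgroup_null_subgroup])
  have "comm_group (G\<lparr>carrier := null_subgroup\<rparr>)"
    by (rule sub.group_comm_groupI) (auto simp: null_subgroup_carrier m_comm)
  moreover have "continuous_map (prod_topology metric.mtopology metric.mtopology) metric.mtopology (\<lambda>(x, y). x \<otimes> y)"
    unfolding metric.continuous_map_to_metric
  proof (intro ballI allI impI)
    fix p and e :: real
    assume p: "p \<in> topspace (prod_topology metric.mtopology metric.mtopology)" and e: "e > 0"
    then obtain x y where xy: "p = (x, y)" "x \<in> null_subgroup" "y \<in> null_subgroup" by auto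
    let ?U = "metric.mball x (e/2) \<times> metric.mball y (e/2)"
    have "openin (prod_topology metric.mtopology metric.mtopology) ?U" by (simp add: openin_prod_Times_iff)
    moreover have "p \<in> ?U" using xy e by simp
    moreover have "(case q of (x, y) \<Rightarrow> x \<otimes> y) \<in> metric.mball (case p of (x, y) \<Rightarrow> x \<otimes> y) e"
      if q: "q \<in> ?U" for q
    proof -
      obtain x' y' where q': "q = (x', y')" "x' \<in> null_subgroup" "y' \<in> null_subgroup" "weighted_dist x x' < e/2" "weighted_dist y y' < e/2"
        using q by auto
      then have "weighted_dist (x \<otimes> y) (x' \<otimes> y') < e"
        using weighted_dist_mult_le[of x y x' y'] xy null_subgroup_carrier by auto
      then show ?thesis using xy q' subgroup.m_closed[OF subgroup_null_subgroup] by simp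
    qed
    ultimately show "\<exists>U. openin (prod_topology metric.mtopology metric.mtopology) U \<and> p \<in> U \<and>
        (\<forall>q\<in>U. (case q of (x, y) \<Rightarrow> x \<otimes> y) \<in> metric.mball (case p of (x, y) \<Rightarrow> x \<otimes> y) e)" by blast
  qed
  moreover have "continuous_map metric.mtopology metric.mtopology (\<lambda>x. inv\<^bsub>G\<lparr>carrier := null_subgroup\<rparr>\<^esub> x)"
    unfolding metric.continuous_map_to_metric
  proof (intro ballI allI impI)
    fix x and e :: real
    assume "x \<in> topspace metric.mtopology" and e: "e > 0"
    then have x: "x \<in> null_subgroup" by simp
    have "inv\<^bsub>G\<lparr>carrier := null_subgroup\<rparr>\<^esub> y \<in> metric.mball (inv\<^bsub>G\<lparr>carrier := null_subgroup\<rparr>\<^esub> x) e"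
      if "y \<in> metric.mball x e" for y
      using that x subgroup.m_inv_closed[OF subgroup_null_subgroup]
      by (simp add: m_inv_consistent[OF subgroup_null_subgroup] weighted_dist_inv null_subgroup_carrier)
    then show "\<exists>U. openin metric.mtopology U \<and> x \<in> U \<and>
        (\<forall>y\<in>U. inv\<^bsub>G\<lparr>carrier := null_subgroup\<rparr>\<^esub> y \<in> metric.mball (inv\<^bsub>G\<lparr>carrier := null_subgroup\<rparr>\<^esub> x) e)"
      using x e by (intro exI[of _ "metric.mball x e"]) simp
  qed
  ultimately show ?thesis
    unfolding abelian_topological_group_def abelian_topological_group_axioms_def by simp
qed

end

section \<open>Completeness, separability and local quasi-convexity\<close>

context weighted_characters
begin

text \<open>
  A Cauchy sequence has a subsequence converging in the compact topology, which is coarser, and the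
  Cauchy estimates hold uniformly over the characters, so they pass to the limit.  Uniformity also
  keeps the limit in the subgroup.
\<close>

lemma mcomplete_null_subgroup: "metric.mcomplete"
  unfolding metric.mcomplete_def
proof (intro allI impI)
  fix \<sigma> assume \<sigma>: "metric.MCauchy \<sigma>"
  then have \<sigma>null_subgroup: "\<sigma> k \<in> null_subgroup" for k unfolding metric.MCauchy_def by auto
  then have \<sigma>G: "\<sigma> k \<in> carrier G" for k by (rule null_subgroup_carrier)
  obtain l r where l: "l \<in> carrier G" and r: "strict_mono (r::nat \<Rightarrow> nat)"
    and lim: "limitin T (\<sigma> \<circ> r) l sequentially"
  proof -
    obtain N d where "Metric_space N d" and T: "T = Metric_space.mtopology N d"
      using metrizable unfolding metrizable_space_def by blast
    interpret T: Metric_space N d by fact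
    have N: "N = carrier G" using topspace_eq_carrier unfolding T by simp
    have "range \<sigma> \<subseteq> N" using \<sigma>G N by auto
    then have "\<exists>l r. l \<in> N \<and> strict_mono (r::nat \<Rightarrow> nat) \<and> limitin T (\<sigma> \<circ> r) l sequentially"
      using compact unfolding T T.compact_space_sequentially by blast
    then show thesis using that N by blast
  qed
  have vlim: "(\<lambda>j. v n (\<sigma> (r j))) \<longlonglongrightarrow> v n l" for n
    using continuous_map_limit[OF character_continuous[OF characters] lim, of n] by (simp add: o_def)
  have unif: "\<exists>N. \<forall>k\<ge>N. \<forall>n. w n * norm (v n (\<sigma> k) - v n l) \<le> e" if e: "e > 0" for e
  proof -
    obtain N where N: "\<And>k k'. \<lbrakk>k \<ge> N; k' \<ge> N\<rbrakk> \<Longrightarrow> weighted_dist (\<sigma> k) (\<sigma> k') < e"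
      using \<sigma> e unfolding metric.MCauchy_def by blast
    have "w n * norm (v n (\<sigma> k) - v n l) \<le> e" if k: "k \<ge> N" for k n
    proof (rule LIMSEQ_le_const2)
      show "(\<lambda>j. w n * norm (v n (\<sigma> k) - v n (\<sigma> (r j)))) \<longlonglongrightarrow> w n * norm (v n (\<sigma> k) - v n l)"
        by (intro tendsto_intros vlim)
      have "w n * norm (v n (\<sigma> k) - v n (\<sigma> (r j))) \<le> e" if "j \<ge> N" for j
      proof -
        have "r j \<ge> N" using seq_suble[OF r, of j] that by linarith
        then show ?thesis
          using weighted_diff_le_weighted_dist[OF \<sigma>G \<sigma>G, of n k "r j"] N[OF k, of "r j"] by linarith
      qed
      then show "\<exists>N. \<forall>j\<ge>N. w n * norm (v n (\<sigma> k) - v n (\<sigma> (r j))) \<le> e" by blast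
    qed
    then show ?thesis by blast
  qed
  have "(\<lambda>n. w n * norm (v n l - 1)) \<longlonglongrightarrow> 0"
  proof (rule LIMSEQ_I)
    fix e :: real assume e: "e > 0"
    then obtain k where k: "\<And>n. w n * norm (v n (\<sigma> k) - v n l) \<le> e/2"
      using unif[of "e/2"] by auto
    have "(\<lambda>n. w n * norm (v n (\<sigma> k) - 1)) \<longlonglongrightarrow> 0" using \<sigma>null_subgroup[of k] unfolding null_subgroup_def by simp
    then obtain N where N: "\<And>n. n \<ge> N \<Longrightarrow> norm (w n * norm (v n (\<sigma> k) - 1) - 0) < e/2"
      using LIMSEQ_D[of _ 0 "e/2"] e by force
    have "norm (w n * norm (v n l - 1) - 0) < e" if "n \<ge> N" for n
    proof -
      have "w n * norm (v n l - 1) \<le> w n * (norm (v n (\<sigma> k) - v n l) + norm (v n (\<sigma> k) - 1))"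
        using weight_pos[of n] norm_triangle_ineq4[of "v n (\<sigma> k) - 1" "v n (\<sigma> k) - v n l"]
        by (intro mult_left_mono) auto
      also have "\<dots> < e" using k[of n] N[OF that] by (simp add: distrib_left abs_less_iff)
      finally show ?thesis using weight_pos[of n] by (simp add: abs_mult)
    qed
    then show "\<exists>N. \<forall>n\<ge>N. norm (w n * norm (v n l - 1) - 0) < e" by blast
  qed
  then have lH: "l \<in> null_subgroup" using l unfolding null_subgroup_def by simp
  moreover have "\<exists>N. \<forall>k\<ge>N. \<sigma> k \<in> null_subgroup \<and> weighted_dist (\<sigma> k) l < e" if e: "e > 0" for e
  proof -
    obtain N where N: "\<And>k n. k \<ge> N \<Longrightarrow> w n * norm (v n (\<sigma> k) - v n l) \<le> e/2"
      using unif[of "e/2"] e by auto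
    have "weighted_dist (\<sigma> k) l \<le> e/2" if "k \<ge> N" for k
      by (intro iffD2[OF weighted_dist_le_iff] allI N[OF that] l \<sigma>G)
    then show ?thesis using \<sigma>null_subgroup e by (intro exI[of _ N]) fastforce
  qed
  ultimately show "\<exists>x. limitin metric.mtopology \<sigma> x sequentially"
    unfolding metric.limit_metric_sequentially by blast
qed

lemma countable_dense_subset:
  assumes "A \<subseteq> carrier G"
  obtains D where "countable D" "D \<subseteq> A" "A \<subseteq> T closure_of D"
proof -
  have top: "topspace (subtopology T A) = A" using assms by (auto simp: topspace_eq_carrier)
  have "separable_space (subtopology T A)"
    by (intro second_countable_imp_separable_space second_countable_subtopology second_countable)
  then obtain D where D: "countable D" "D \<subseteq> A" "subtopology T A closure_of D = A"
    unfolding separable_space_def top by blast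
  then have "A \<subseteq> T closure_of D" using closure_of_subtopology_subset[of T A D] by simp
  with D that show thesis by blast
qed

text \<open>
  On the set where the tails of \<open>w n * norm (v n x - 1)\<close> beyond a fixed index are
  uniformly small, distances are controlled, up to a small error, by finitely many characters, so
  the separability of the compact group applies; countably many such sets exhaust the subgroup.
\<close>

lemma separable_null_subgroup: "separable_space metric.mtopology"
proof -
  define F where "F m N = {x \<in> null_subgroup. \<forall>n\<ge>N. w n * norm (v n x - 1) \<le> inverse (real (Suc m))}" for m N
  have "F m N \<subseteq> carrier G" for m N unfolding F_def using null_subgroup_carrier by auto
  then have "\<exists>D. countable D \<and> D \<subseteq> F m N \<and> F m N \<subseteq> T closure_of D" for m N
    using countable_dense_subset[of "F m N"] by metis
  then obtain D where D: "\<And>m N. countable (D m N)" "\<And>m N. D m N \<subseteq> F m N"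
    "\<And>m N. F m N \<subseteq> T closure_of (D m N)" by metis
  define C where "C = (\<Union>m. \<Union>N. D m N)"
  have C: "countable C" unfolding C_def using D(1) by (intro countable_UN) auto
  have CH: "C \<subseteq> null_subgroup" unfolding C_def using D(2) by (force simp: F_def)
  have "\<exists>y\<in>C. y \<in> metric.mball x r" if x: "x \<in> null_subgroup" and r: "r > 0" for x r
  proof -
    have xG: "x \<in> carrier G" using x by (rule null_subgroup_carrier)
    obtain m where m: "inverse (real (Suc m)) < r/2" using reals_Archimedean[of "r/2"] r by auto
    \<comment> \<open>Characters of index below \<open>N\<close> are handled by density, the others by the tail bound.\<close>
    define e where "e = inverse (real (Suc m))"
    have e: "e > 0" unfolding e_def by simp
    have "(\<lambda>n. w n * norm (v n x - 1)) \<longlonglongrightarrow> 0" using x unfolding null_subgroup_def by simp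
    then obtain N where N: "\<And>n. n \<ge> N \<Longrightarrow> norm (w n * norm (v n x - 1) - 0) < e"
      using LIMSEQ_D[of _ 0 e] e by blast
    have "w n * norm (v n x - 1) \<le> e" if "n \<ge> N" for n using N[OF that] by simp
    then have xF: "x \<in> F m N" unfolding F_def e_def using x by simp
    let ?s = "\<lambda>y. \<Sum>n<N. norm (v n y - v n x)"
    have "continuous_map T euclideanreal ?s"
      by (intro continuous_map_sum continuous_map_norm continuous_map_diff
          character_continuous[OF characters] continuous_function_const) auto
    then have "openin T {y \<in> topspace T. ?s y \<in> {..<e}}"
      by (rule openin_continuous_map_preimage) simp
    moreover have "x \<in> {y \<in> topspace T. ?s y \<in> {..<e}}" using xG e by (simp add: topspace_eq_carrier)
    moreover have "x \<in> T closure_of (D m N)" using D(3) xF by blast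
    ultimately have "\<exists>y. y \<in> D m N \<and> y \<in> {y \<in> topspace T. ?s y \<in> {..<e}}"
      unfolding in_closure_of by presburger
    then obtain y where y: "y \<in> D m N" "?s y < e" by auto
    have yF: "y \<in> F m N" using D(2) y by blast
    then have yH: "y \<in> null_subgroup" unfolding F_def by simp
    have yG: "y \<in> carrier G" using yH by (rule null_subgroup_carrier)
    have "w n * norm (v n x - v n y) \<le> 2 * e" for n
    proof (cases "n < N")
      case True
      have "w n * norm (v n x - v n y) \<le> 1 * norm (v n y - v n x)"
        using weight_le_one[of n] by (subst norm_minus_commute, intro mult_right_mono) auto
      also have "\<dots> \<le> ?s y" using True member_le_sum[of n "{..<N}" "\<lambda>n. norm (v n y - v n x)"] by simp
      finally show ?thesis using y(2) e by linarith
    next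
      case False
      have "w n * norm (v n x - v n y) \<le> w n * (norm (v n x - 1) + norm (v n y - 1))"
        using weight_pos[of n] norm_triangle_ineq4[of "v n x - 1" "v n y - 1"] by (intro mult_left_mono) auto
      also have "\<dots> \<le> e + e"
        using xF yF False unfolding F_def e_def distrib_left by (intro add_mono) auto
      finally show ?thesis by simp
    qed
    then have "weighted_dist x y \<le> 2 * e" using xG yG by (simp add: weighted_dist_le_iff)
    also have "\<dots> < r" using m unfolding e_def by simp
    finally have "y \<in> metric.mball x r" using x yH by simp
    moreover have "y \<in> C" unfolding C_def using y by blast
    ultimately show ?thesis by blast
  qed
  then have "metric.mtopology closure_of C = null_subgroup" unfolding metric.metric_closure_of by blast
  with C CH show ?thesis unfolding separable_space_def by (intro exI[of _ C]) simp
qed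

lemma power_character_null_subgroup: "(\<lambda>x. v n x ^ k) \<in> characters (G\<lparr>carrier := null_subgroup\<rparr>) metric.mtopology"
proof -
  have "continuous_map metric.mtopology Met_TC.mtopology (v n)"
    unfolding Met_TC.continuous_map_to_metric
  proof (intro ballI allI impI)
    fix x and e :: real assume "x \<in> topspace metric.mtopology" and e: "e > 0"
    then have x: "x \<in> null_subgroup" by simp
    have "v n y \<in> Met_TC.mball (v n x) e" if y: "y \<in> metric.mball x (w n * e)" for y
    proof -
      have "w n * norm (v n x - v n y) < w n * e"
        using weighted_diff_le_weighted_dist[of x y n] y null_subgroup_carrier by fastforce
      then show ?thesis using weight_pos[of n] by (simp add: dist_norm)
    qed
    then show "\<exists>U. openin metric.mtopology U \<and> x \<in> U \<and> (\<forall>y\<in>U. v n y \<in> Met_TC.mball (v n x) e)"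
      using x e weight_pos[of n] by (intro exI[of _ "metric.mball x (w n * e)"]) simp
  qed
  then have v: "continuous_map metric.mtopology euclidean (v n)" by simp
  have "continuous_map euclidean euclidean (\<lambda>z::complex. z ^ k)"
    by (simp add: continuous_on_power)
  from continuous_map_compose[OF v this]
  have "continuous_map metric.mtopology euclidean (\<lambda>x. v n x ^ k)" by (simp add: o_def)
  then show ?thesis
    unfolding characters_def hom_def circle_group_def
    by (auto simp: continuous_map_in_subtopology null_subgroup_carrier norm_v norm_power v_mult power_mult_distrib)
qed

text \<open>
  A set defined by conditions \<open>Re (v n x ^ k) \<ge> 0\<close> is quasi-convex by definition,
  as the functions \<open>v n ^ k\<close> restrict to characters. The conditions with \<open>k = 2 ^
  i\<close>, \<open>i \<le> m\<close>, imposed on all characters whose weight is not small, confine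
  \<open>x\<close> to a small ball; since the exponents are bounded, all of them hold on some
  smaller ball, even if infinitely many characters take part.
\<close>

lemma locally_quasi_convex_null_subgroup: "locally_quasi_convex (G\<lparr>carrier := null_subgroup\<rparr>) metric.mtopology"
  unfolding locally_quasi_convex_def neighbourhood_base_at_def
proof (intro allI impI)
  let ?H = "G\<lparr>carrier := null_subgroup\<rparr>"
  fix W assume "openin metric.mtopology W \<and> \<one>\<^bsub>?H\<^esub> \<in> W"
  then obtain e where e: "e > 0" "metric.mball \<one> e \<subseteq> W"
    unfolding metric.openin_mtopology by auto
  have oneH: "\<one> \<in> null_subgroup" by (rule subgroup.one_closed[OF subgroup_null_subgroup])
  obtain m where m: "2 / sqrt 2 ^ m \<le> e/2"
  proof -
    have "1 < sqrt (2::real)" by simp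
    then obtain m where "4 / e < sqrt 2 ^ m" using real_arch_pow by blast
    then show thesis using that[of m] e(1) by (simp add: field_simps)
  qed
  define I where "I = {n. w n > e/4}"
  define V where "V = {x \<in> null_subgroup. \<forall>n\<in>I. \<forall>i\<le>m. 0 \<le> Re (v n x ^ (2 ^ i))}"
  \<comment> \<open>Weights exceed \<open>e/4\<close> on \<open>I\<close> and exponents are at most \<open>2 ^ m\<close>, so powers move by less than \<open>1\<close>.\<close>
  define \<delta> where "\<delta> = e / 4 / 2 ^ m"
  have \<delta>: "\<delta> > 0" unfolding \<delta>_def using e by simp
  have "quasi_convex ?H metric.mtopology V"
    unfolding quasi_convex_def
  proof (intro conjI ballI)
    show "V \<subseteq> carrier ?H" unfolding V_def by auto
    fix y assume y: "y \<in> carrier ?H - V"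
    then obtain n i where ni: "n \<in> I" "i \<le> m" "Re (v n y ^ (2 ^ i)) < 0"
      unfolding V_def by (auto simp: not_le)
    show "\<exists>\<psi>\<in>characters ?H metric.mtopology. \<psi> ` V \<subseteq> right_half_circle \<and> \<psi> y \<notin> right_half_circle"
    proof (intro bexI conjI)
      show "(\<lambda>x. v n x ^ (2 ^ i)) ` V \<subseteq> right_half_circle"
        using ni unfolding V_def right_half_circle_def circle_group_def
        by (auto simp: norm_power norm_v null_subgroup_carrier)
      show "v n y ^ (2 ^ i) \<notin> right_half_circle" using ni unfolding right_half_circle_def by simp
    qed (rule power_character_null_subgroup)
  qed
  moreover have "metric.mball \<one> \<delta> \<subseteq> V"
  proof
    fix x assume x: "x \<in> metric.mball \<one> \<delta>"
    then have xH: "x \<in> null_subgroup" and xG: "x \<in> carrier G" using null_subgroup_carrier by auto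
    have "0 \<le> Re (v n x ^ (2 ^ i))" if n: "n \<in> I" and i: "i \<le> m" for n i
    proof -
      have "e/4 * norm (v n x - 1) \<le> w n * norm (v n x - 1)"
        using n unfolding I_def by (intro mult_right_mono) auto
      also have "\<dots> < \<delta>" using weighted_diff_le_weighted_dist[OF one_closed xG, of n] x
        by (simp add: v_one norm_minus_commute)
      finally have "e/4 * (norm (v n x - 1) * 2 ^ m) < e/4 * 1" unfolding \<delta>_def by (simp add: field_simps)
      then have small: "norm (v n x - 1) * 2 ^ m < 1" by (rule mult_left_less_imp_less) (use e in simp)
      have "norm (v n x ^ (2 ^ i) - 1 ^ (2 ^ i)) \<le> real (2 ^ i) * norm (v n x - 1)"
        using norm_v[OF xG, of n] by (intro norm_power_diff) auto
      also have "\<dots> \<le> 2 ^ m * norm (v n x - 1)" using i by (intro mult_right_mono) (auto intro: power_increasing)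
      finally have "norm (v n x ^ (2 ^ i) - 1) < 1" using small by (simp add: mult.commute)
      then show ?thesis using abs_Re_le_cmod[of "v n x ^ (2 ^ i) - 1"] by simp
    qed
    then show "x \<in> V" unfolding V_def using xH by simp
  qed
  moreover have "V \<subseteq> metric.mball \<one> e"
  proof
    fix x assume x: "x \<in> V"
    then have xH: "x \<in> null_subgroup" and xG: "x \<in> carrier G" unfolding V_def using null_subgroup_carrier by auto
    have "w n * norm (v n \<one> - v n x) \<le> e/2" for n
    proof (cases "n \<in> I")
      case True
      have "norm (v n x - 1) \<le> 2 / sqrt 2 ^ m"
        using x True by (intro norm_diff_one_le_of_powers_in_right_half norm_v xG) (auto simp: V_def)
      then have "w n * norm (v n x - 1) \<le> 1 * (e/2)"
        using m weight_le_one[of n] by (intro mult_mono) auto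
      then show ?thesis by (simp add: v_one norm_minus_commute)
    next
      case False
      have "norm (v n \<one> - v n x) \<le> 2"
        using norm_triangle_ineq4[of "v n \<one>" "v n x"] xG by (simp add: norm_v)
      then have "w n * norm (v n \<one> - v n x) \<le> e/4 * 2"
        using False weight_pos[of n] e unfolding I_def by (intro mult_mono) auto
      then show ?thesis by simp
    qed
    then have "\<forall>n. w n * norm (v n \<one> - v n x) \<le> e/2" ..
    then have "weighted_dist \<one> x \<le> e/2" by (rule iffD2[OF weighted_dist_le_iff[OF one_closed xG]])
    then show "x \<in> metric.mball \<one> e" using oneH xH e by simp
  qed
  ultimately show "\<exists>U V. openin metric.mtopology U \<and> quasi_convex ?H metric.mtopology V \<and>
      \<one>\<^bsub>?H\<^esub> \<in> U \<and> U \<subseteq> V \<and> V \<subseteq> W"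
    using oneH \<delta> e by (intro exI[of _ "metric.mball \<one> \<delta>"] exI[of _ V]) auto
qed

theorem polish_locally_quasi_convex_null_subgroup:
  "polish_group_topology (G\<lparr>carrier := null_subgroup\<rparr>) metric.mtopology"
  "locally_quasi_convex (G\<lparr>carrier := null_subgroup\<rparr>) metric.mtopology"
  unfolding polish_group_topology_def completely_metrizable_space_def
  using abelian_topological_group_null_subgroup separable_null_subgroup mcomplete_null_subgroup metric.Metric_space_axioms
    locally_quasi_convex_null_subgroup by auto

end

text \<open>
  The given characters receive weight \<open>1\<close> at the even indices, a separating sequence
  receives weights tending to \<open>0\<close> at the odd ones. The latter make the distance
  separate points without affecting the subgroup.
\<close>

theorem corollary1:
  fixes X :: "('a, 'b) monoid_scheme" and T :: "'a topology"
    and u :: "nat \<Rightarrow> 'a \<Rightarrow> complex"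
  assumes "abelian_topological_group X T"
    and "compact_space T"
    and "metrizable_space T"
    and "\<And>n. u n \<in> characters X T"
  shows "\<exists>S. polish_group_topology (X\<lparr>carrier := characterized_subgroup X u\<rparr>) S
           \<and> locally_quasi_convex (X\<lparr>carrier := characterized_subgroup X u\<rparr>) S"
proof -
  interpret X: compact_metrizable_abelian_group X T
    using assms(1-3) by (simp add: compact_metrizable_abelian_group_def compact_metrizable_abelian_group_axioms_def)
  obtain \<theta> :: "nat \<Rightarrow> 'a \<Rightarrow> complex" where \<theta>: "\<And>n. \<theta> n \<in> characters X T"
    "\<And>a. \<lbrakk>a \<in> carrier X; a \<noteq> \<one>\<^bsub>X\<^esub>\<rbrakk> \<Longrightarrow> \<exists>n. \<theta> n a \<noteq> 1"
    using X.separating_sequence_of_characters by blast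
  define v where "v n = (if even n then u (n div 2) else \<theta> (n div 2))" for n
  define w where "w n = (if even n then 1 else inverse (real (Suc n)))" for n
  interpret W: weighted_characters X T v w
  proof
    show "v n \<in> characters X T" for n unfolding v_def using assms(4) \<theta>(1) by simp
    show "\<exists>n. v n a \<noteq> 1" if a: "a \<in> carrier X" "a \<noteq> \<one>\<^bsub>X\<^esub>" for a
    proof -
      obtain n where "\<theta> n a \<noteq> 1" using \<theta>(2)[OF a] by blast
      then have "v (Suc (2 * n)) a \<noteq> 1" unfolding v_def by simp
      then show ?thesis by blast
    qed
    show "0 < w n" "w n \<le> 1" for n unfolding w_def by (auto simp: inverse_le_1_iff)
  qed
  have "(\<lambda>n. w n * norm (v n x - 1)) \<longlonglongrightarrow> 0 \<longleftrightarrow> (\<lambda>n. u n x) \<longlonglongrightarrow> 1" if x: "x \<in> carrier X" for x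
  proof
    assume "(\<lambda>n. w n * norm (v n x - 1)) \<longlonglongrightarrow> 0"
    then have "((\<lambda>n. w n * norm (v n x - 1)) \<circ> (\<lambda>n. 2 * n)) \<longlonglongrightarrow> 0"
      by (rule LIMSEQ_subseq_LIMSEQ) (simp add: strict_mono_def)
    then have "(\<lambda>n. norm (u n x - 1)) \<longlonglongrightarrow> 0" by (simp add: o_def v_def w_def)
    then show "(\<lambda>n. u n x) \<longlonglongrightarrow> 1" by (rule LIM_zero_cancel[OF tendsto_norm_zero_cancel])
  next
    assume u: "(\<lambda>n. u n x) \<longlonglongrightarrow> 1"
    show "(\<lambda>n. w n * norm (v n x - 1)) \<longlonglongrightarrow> 0"
    proof (rule LIMSEQ_I)
      fix e :: real assume e: "e > 0"
      obtain N1 where N1: "\<And>n. n \<ge> N1 \<Longrightarrow> norm (u n x - 1) < e"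
        using LIMSEQ_D[OF u e] by blast
      obtain N2 :: nat where N2: "2 / e < N2" using reals_Archimedean2 by blast
      have "norm (w n * norm (v n x - 1) - 0) < e" if n: "n \<ge> 2 * N1 + N2" for n
      proof (cases "even n")
        case True
        then show ?thesis using N1[of "n div 2"] n by (simp add: v_def w_def)
      next
        case False
        have "norm (v n x - 1) \<le> 2"
          using norm_triangle_ineq4[of "v n x" 1] W.norm_v[OF x, of n] by simp
        then have "w n * norm (v n x - 1) \<le> inverse (real (Suc n)) * 2"
          using False by (simp add: w_def)
        also have "\<dots> < e"
        proof -
          have "2 / e < real (Suc n)" using N2 n by linarith
          then show ?thesis using e by (simp add: field_simps)
        qed
        finally show ?thesis using W.weight_pos[of n] by (simp add: abs_mult)
      qed
      then show "\<exists>N. \<forall>n\<ge>N. norm (w n * norm (v n x - 1) - 0) < e" by blast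
    qed
  qed
  then have "W.null_subgroup = characterized_subgroup X u"
    unfolding W.null_subgroup_def characterized_subgroup_def by auto
  then show ?thesis using W.polish_locally_quasi_convex_null_subgroup by auto
qed

end
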